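(* Let $G$ be a simple loopless graph on $[L]$ and let $s_1,\dots,s_L$ be $G$-independent semicircle variables in a $C^*$-probability space $(\mathcal{A},\tau)$ with faithful tracial state $\tau$. Let $A$ be the adjacency operator of the Cayley graph $\operatorname{Cay}(\mathcal{T}(G))$ of the trace monoid $\mathcal{T}(G)$, acting on $\ell^2(\mathcal{T}(G))$. Then \[ \Big\|\sum_{i=1}^{L}s_i\Big\|=\|A\|. \]
   Context: A semicircle variable is a self-adjoint element with standard semicircle distribution (density $\frac{1}{2\pi}\sqrt{4-x^2}$ on $[-2,2]$). Unital subalgebras $\mathcal{A}_1,\dots,\mathcal{A}_L$ are $G$-independent if: (i) for every edge $(i,j)\in E(G)$, $\mathcal{A}_i$ and $\mathcal{A}_j$ are classically independent (commuting, tensor independent); (ii) for every $k\ge1$ and $(i_1,\dots,i_k)\in[L]^k$ such that whenever $i_{j_1}=i_{j_2}$ with $j_1<j_2$ there is $j_3$ with $j_1<j_3<j_2$ and $(i_{j_1},i_{j_3})\notin E(G)$, one has $\tau(a_1\cdots a_k)=0$ for all centered $a_j\in\mathcal{A}_{i_j}$. Variables are $G$-independent if the unital $*$-subalgebras they generate are. The trace monoid of $G$ is the monoid with presentation $\mathcal{T}(G)=\langle v\in V(G) : uv=vu \text{ for all } (u,v)\in E(G)\rangle$ (words in the letters $[L]$ modulo commutation of adjacent letters), with empty word $e$. Two words $w_1,w_2\in\mathcal{T}(G)$ are adjacent if there is a letter $v\in[L]$ with $w_1=vw_2$ or $w_2=vw_1$; $\operatorname{Cay}(\mathcal{T}(G))$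 is the graph on vertex set $\mathcal{T}(G)$ with these adjacencies, and $\|A\|$ is the operator norm of its adjacency operator on $\ell^2(\mathcal{T}(G))$. *)

theory Defs
  imports "HOL-Analysis.Analysis"
begin

class cstar_algebra = real_normed_algebra_1 + banach +
  fixes scaleC :: "complex \<Rightarrow> 'a \<Rightarrow> 'a"
    and adj :: "'a \<Rightarrow> 'a"
  assumes scaleC_of_real: "scaleC (complex_of_real r) x = scaleR r x"
    and scaleC_add_right: "scaleC c (x + y) = scaleC c x + scaleC c y"
    and scaleC_add_left: "scaleC (c + d) x = scaleC c x + scaleC d x"
    and scaleC_scaleC: "scaleC c (scaleC d x) = scaleC (c * d) x"
    and norm_scaleC: "norm (scaleC c x) = cmod c * norm x"
    and mult_scaleC_left: "scaleC c x * y = scaleC c (x * y)"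
    and mult_scaleC_right: "x * scaleC c y = scaleC c (x * y)"
    and adj_adj: "adj (adj x) = x"
    and adj_add: "adj (x + y) = adj x + adj y"
    and adj_scaleC: "adj (scaleC c x) = scaleC (cnj c) (adj x)"
    and adj_mult: "adj (x * y) = adj y * adj x"
    and cstar_identity: "norm (adj x * x) = norm x * norm x"

definition faithful_tracial_state :: "('a::cstar_algebra \<Rightarrow> complex) \<Rightarrow> bool" where
  "faithful_tracial_state \<tau> \<longleftrightarrow>
     (\<forall>x y. \<tau> (x + y) = \<tau> x + \<tau> y) \<and>
     (\<forall>c x. \<tau> (scaleC c x) = c * \<tau> x) \<and>
     (\<forall>x. Im (\<tau> (adj x * x)) = 0 \<and> Re (\<tau> (adj x * x)) \<ge> 0) \<and>
     \<tau> 1 = 1 \<and>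
     (\<forall>x y. \<tau> (x * y) = \<tau> (y * x)) \<and>
     (\<forall>x. \<tau> (adj x * x) = 0 \<longrightarrow> x = 0)"

definition semicircle_var :: "('a::cstar_algebra \<Rightarrow> complex) \<Rightarrow> 'a \<Rightarrow> bool" where
  "semicircle_var \<tau> s \<longleftrightarrow> adj s = s \<and>
     (\<forall>n::nat. \<tau> (s ^ n) =
        complex_of_real (integral {-2..2} (\<lambda>x::real. x ^ n * sqrt (4 - x\<^sup>2) / (2 * pi))))"

inductive_set gen_star_alg :: "'a::cstar_algebra \<Rightarrow> 'a set" for s :: 'a where
  gen_one: "1 \<in> gen_star_alg s"
| gen_elem: "s \<in> gen_star_alg s"
| gen_add: "x \<in> gen_star_alg s \<Longrightarrow> y \<in> gen_star_alg s \<Longrightarrow> x + y \<in> gen_star_alg s"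
| gen_mult: "x \<in> gen_star_alg s \<Longrightarrow> y \<in> gen_star_alg s \<Longrightarrow> x * y \<in> gen_star_alg s"
| gen_scaleC: "x \<in> gen_star_alg s \<Longrightarrow> scaleC c x \<in> gen_star_alg s"
| gen_adj: "x \<in> gen_star_alg s \<Longrightarrow> adj x \<in> gen_star_alg s"

definition simple_graph_on :: "nat \<Rightarrow> (nat \<Rightarrow> nat \<Rightarrow> bool) \<Rightarrow> bool" where
  "simple_graph_on L E \<longleftrightarrow>
     (\<forall>i j. E i j \<longrightarrow> E j i) \<and> (\<forall>i. \<not> E i i) \<and>
     (\<forall>i j. E i j \<longrightarrow> i \<in> {1..L} \<and> j \<in> {1..L})"

definition G_independent ::
  "nat \<Rightarrow> (nat \<Rightarrow> nat \<Rightarrow> bool) \<Rightarrow> ('a::cstar_algebra \<Rightarrow> complex) \<Rightarrow> (nat \<Rightarrow> 'a set) \<Rightarrow> bool" where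
  "G_independent L E \<tau> A \<longleftrightarrow>
     (\<forall>i j. E i j \<longrightarrow>
        (\<forall>a\<in>A i. \<forall>b\<in>A j. a * b = b * a \<and> \<tau> (a * b) = \<tau> a * \<tau> b)) \<and>
     (\<forall>(idx::nat list) (as::'a list).
        length idx \<ge> 1 \<longrightarrow> length as = length idx \<longrightarrow> set idx \<subseteq> {1..L} \<longrightarrow>
        (\<forall>j1 j2. j1 < j2 \<and> j2 < length idx \<and> idx ! j1 = idx ! j2 \<longrightarrow>
           (\<exists>j3. j1 < j3 \<and> j3 < j2 \<and> \<not> E (idx ! j1) (idx ! j3))) \<longrightarrow>
        (\<forall>j < length idx. as ! j \<in> A (idx ! j) \<and> \<tau> (as ! j) = 0) \<longrightarrow>
        \<tau> (prod_list as) = 0)"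

definition G_independent_vars ::
  "nat \<Rightarrow> (nat \<Rightarrow> nat \<Rightarrow> bool) \<Rightarrow> ('a::cstar_algebra \<Rightarrow> complex) \<Rightarrow> (nat \<Rightarrow> 'a) \<Rightarrow> bool" where
  "G_independent_vars L E \<tau> s \<longleftrightarrow> G_independent L E \<tau> (\<lambda>i. gen_star_alg (s i))"

text \<open>Words over letters {1..L}, modulo commuting adjacent letters u v with E u v.
  An element of the trace monoid is the equivalence class (a set of words).\<close>

definition tm_swap :: "(nat \<Rightarrow> nat \<Rightarrow> bool) \<Rightarrow> (nat list \<times> nat list) set" where
  "tm_swap E = {(xs @ [u, v] @ ys, xs @ [v, u] @ ys) | xs ys u v. E u v}"

definition tm_class :: "(nat \<Rightarrow> nat \<Rightarrow> bool) \<Rightarrow> nat list \<Rightarrow> nat list set" where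
  "tm_class E xs = {ys. (xs, ys) \<in> (tm_swap E \<union> (tm_swap E)\<inverse>)\<^sup>*}"

definition trace_monoid :: "nat \<Rightarrow> (nat \<Rightarrow> nat \<Rightarrow> bool) \<Rightarrow> nat list set set" where
  "trace_monoid L E = tm_class E ` {xs. set xs \<subseteq> {1..L}}"

definition cay_adjacent :: "nat \<Rightarrow> (nat \<Rightarrow> nat \<Rightarrow> bool) \<Rightarrow> nat list set \<Rightarrow> nat list set \<Rightarrow> bool" where
  "cay_adjacent L E w1 w2 \<longleftrightarrow>
     (\<exists>v\<in>{1..L}. \<exists>xs\<in>w2. w1 = tm_class E (v # xs)) \<or>
     (\<exists>v\<in>{1..L}. \<exists>xs\<in>w1. w2 = tm_class E (v # xs))"

definition cay_adj_op :: "nat \<Rightarrow> (nat \<Rightarrow> nat \<Rightarrow> bool) \<Rightarrow> (nat list set \<Rightarrow> complex) \<Rightarrow> nat list set \<Rightarrow> complex" where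
  "cay_adj_op L E f w = (\<Sum>w'\<in>{w'\<in>trace_monoid L E. cay_adjacent L E w w'}. f w')"

definition cay_adj_norm :: "nat \<Rightarrow> (nat \<Rightarrow> nat \<Rightarrow> bool) \<Rightarrow> real" where
  "cay_adj_norm L E =
     (SUP f \<in> {f. (\<lambda>w. (cmod (f w))\<^sup>2) summable_on trace_monoid L E \<and>
                 (\<Sum>\<^sub>\<infinity>w\<in>trace_monoid L E. (cmod (f w))\<^sup>2) \<le> 1}.
        sqrt (\<Sum>\<^sub>\<infinity>w\<in>trace_monoid L E. (cmod (cay_adj_op L E f w))\<^sup>2))"

end

theory Submission
  imports Defs "HOL-Computational_Algebra.Formal_Power_Series"
begin

text \<open>
  Each \<open>s\<^sub>v\<close> is modelled by \<open>A\<^sub>v = \<ell>\<^sub>v + \<ell>\<^sub>v\<^sup>*\<close>, where \<open>\<ell>\<^sub>v\<close> is left multiplication by the letter \<open>v\<close> on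
  \<open>\<ell>\<^sup>2\<close> of the trace monoid, and the adjacency operator is \<open>A = \<Sum>\<^sub>v A\<^sub>v\<close>.  Products of Chebyshev
  polynomials \<open>U\<^sub>n(s\<^sub>j)\<close> along reduced words of blocks \<open>j\<^sup>n\<close> are centred by graph independence and obey
  the same recursion under left multiplication by \<open>s\<^sub>v\<close> as the basis vectors do under \<open>A\<^sub>v\<close>.  Hence
  \<open>p(s) \<mapsto> p(A)\<delta>\<^sub>e\<close> is isometric from the \<open>L\<^sup>2\<close>-norm of the trace onto the finitely supported functions,
  and it intertwines left multiplication by \<open>S = \<Sum>\<^sub>v s\<^sub>v\<close> with \<open>A\<close>.  As left multiplication by \<open>S\<close> is
  bounded by \<open>\<parallel>S\<parallel>\<close> in the \<open>L\<^sup>2\<close>-norm, \<open>\<parallel>A\<parallel> \<le> \<parallel>S\<parallel>\<close>.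

  The converse needs faithfulness on the whole algebra.  If left multiplication by \<open>S\<close> is
  \<open>L\<^sup>2\<close>-bounded by \<open>M\<close>, then polynomials converging uniformly to the truncation of \<open>t\<close> to
  \<open>[-M, M]\<close> converge at \<open>S\<close> in norm to an element of norm at most \<open>M\<close>, and in \<open>L\<^sup>2\<close> to \<open>S\<close>; so
  \<open>\<parallel>S\<parallel> \<le> M\<close>.  The bounds \<open>\<parallel>p(S)\<parallel> \<le> sup \<bar>p\<bar>\<close> this requires come from Chebyshev expansions of the powers
  \<open>p\<^sup>m\<close>, whose loss is only linear in \<open>m\<close>.
\<close>

section \<open>Square roots and states in C*-algebras\<close>

lemma adj_scaleR: "adj (r *\<^sub>R x) = r *\<^sub>R adj (x::'a::cstar_algebra)"
  by (metis adj_scaleC complex_cnj_complex_of_real scaleC_of_real)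

lemma scaleC_zero_left [simp]: "scaleC 0 x = (0::'a::cstar_algebra)"
  using scaleC_of_real[of 0 x] by simp

lemma scaleC_zero_right [simp]: "scaleC c 0 = (0::'a::cstar_algebra)"
  using mult_scaleC_left[of c 1 "0::'a"] by simp

lemma scaleC_one [simp]: "scaleC 1 x = (x::'a::cstar_algebra)"
  using scaleC_of_real[of 1 x] by simp

lemma scaleC_minus_one: "scaleC (-1) x = - (x::'a::cstar_algebra)"
  using scaleC_of_real[of "-1" x] by simp

lemma adj_zero [simp]: "adj 0 = (0::'a::cstar_algebra)"
  using adj_scaleR[of 0 0] by simp

lemma adj_one [simp]: "adj 1 = (1::'a::cstar_algebra)"
  by (metis adj_adj adj_mult mult.left_neutral mult.right_neutral)

lemma adj_minus: "adj (- x) = - adj (x::'a::cstar_algebra)"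
  using adj_scaleR[of "-1" x] by simp

lemma adj_diff: "adj (x - y) = adj x - adj (y::'a::cstar_algebra)"
  using adj_add[of x "- y"] by (simp add: adj_minus)

lemma adj_power: "adj (x ^ n) = adj (x::'a::cstar_algebra) ^ n"
  by (induction n) (simp_all add: adj_mult power_commutes)

lemma adj_sum: "adj (\<Sum>i\<in>I. f i) = (\<Sum>i\<in>I. adj (f i :: 'a::cstar_algebra))"
  by (induction I rule: infinite_finite_induct) (simp_all add: adj_add)

text \<open>The C*-identity gives \<open>norm y * norm y \<le> norm (adj y) * norm y\<close>;
  cancelling, and using this for both \<open>x\<close> and \<open>adj x\<close>, yields
  equality.\<close>

lemma norm_adj [simp]: "norm (adj x) = norm (x::'a::cstar_algebra)"
proof -
  have le: "norm y \<le> norm (adj y)" for y :: 'a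
  proof (cases "y = 0")
    case False
    have "norm y * norm y \<le> norm (adj y) * norm y"
      by (metis cstar_identity norm_mult_ineq)
    thus ?thesis using False by simp
  qed simp
  show ?thesis using le[of x] le[of "adj x"] by (simp add: adj_adj)
qed

lemma bounded_linear_adj: "bounded_linear (adj :: 'a::cstar_algebra \<Rightarrow> 'a)"
  by (rule bounded_linear_intro[where K = 1]) (simp_all add: adj_add adj_scaleR)

text \<open>Squaring a self-adjoint element squares its norm by the C*-identity, which is why the
  power trick below runs over exponents 2^k.\<close>

lemma norm_power_two_selfadjoint:
  fixes x :: "'a::cstar_algebra"
  assumes "adj x = x"
  shows "norm (x ^ (2 ^ k)) = norm x ^ (2 ^ k)"
proof (induction k)
  case (Suc k)
  have "norm (x ^ (2 ^ Suc k)) = norm (adj (x ^ (2 ^ k)) * x ^ (2 ^ k))"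
    using assms by (simp add: adj_power flip: power_add mult_2)
  also have "\<dots> = norm x ^ (2 ^ Suc k)"
    by (simp add: cstar_identity Suc flip: power_add mult_2)
  finally show ?case .
qed simp

text \<open>The root is the binomial series of (1 - h)^(1/2). Vandermonde's identity collapses its
  Cauchy square to the binomial series of exponent 1, and commutation with \<open>h\<close> passes
  to the sum term by term.\<close>

lemma selfadjoint_sqrt_one_minus:
  fixes h :: "'a::cstar_algebra"
  assumes h: "norm h < 1" and sa: "adj h = h"
  obtains k where "adj k = k" "k * k = 1 - h" "\<And>x. x * h = h * x \<Longrightarrow> x * k = k * x"
proof -
  define c :: "nat \<Rightarrow> real" where "c n = (1/2) gchoose n" for n
  define f where "f n = c n *\<^sub>R (- h) ^ n" for n
  \<comment> \<open>For an exponent that is not a natural number the binomial series has radius of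
    convergence 1.\<close>
  have half: "(1/2::real) \<notin> \<nat>"
  proof
    assume "(1/2::real) \<in> \<nat>"
    then obtain m :: nat where "1/2 = real m" by (auto elim: Nats_cases)
    hence "real (2 * m) = real 1" by simp
    hence "2 * m = 1" using of_nat_eq_iff by blast
    thus False by presburger
  qed
  have "summable (\<lambda>n. norm (c n * norm h ^ n))"
    unfolding c_def using h half
    by (intro abs_summable_in_conv_radius) (simp add: conv_radius_gchoose one_ereal_def)
  hence sn: "summable (\<lambda>n. norm (f n))"
  proof (rule summable_comparison_test_ev[rotated])
    have "norm (norm (f n)) \<le> norm (c n * norm h ^ n)" for n
      using norm_power_ineq[of "- h" n]
      by (simp add: f_def abs_mult mult_left_mono)
    thus "\<forall>\<^sub>F n in sequentially. norm (norm (f n)) \<le> norm (c n * norm h ^ n)" by simp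
  qed
  hence s: "summable f" by (rule summable_norm_cancel)
  define k where "k = suminf f"
  have "adj k = (\<Sum>n. adj (f n))"
    unfolding k_def using bounded_linear.suminf[OF bounded_linear_adj s] .
  also have "(\<lambda>n. adj (f n)) = f"
    by (simp add: f_def fun_eq_iff adj_scaleR adj_power adj_minus sa)
  finally have 1: "adj k = k" by (simp add: k_def)
  have "(\<Sum>i\<le>n. f i * f (n - i)) = ((1::real) gchoose n) *\<^sub>R (- h) ^ n" for n
  proof -
    have "(\<Sum>i\<le>n. f i * f (n - i)) = (\<Sum>i\<le>n. (c i * c (n - i)) *\<^sub>R (- h) ^ n)"
      by (rule sum.cong) (simp_all add: f_def flip: power_add)
    also have "\<dots> = (\<Sum>i\<le>n. c i * c (n - i)) *\<^sub>R (- h) ^ n"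
      by (rule scaleR_sum_left[symmetric])
    also have "(\<Sum>i\<le>n. c i * c (n - i)) = (1::real) gchoose n"
      using gbinomial_Vandermonde[of "1/2::real" "1/2" n]
      by (simp add: c_def atLeast0AtMost)
    finally show ?thesis .
  qed
  hence "(\<lambda>n. ((1::real) gchoose n) *\<^sub>R (- h) ^ n) sums (k * k)"
    using Cauchy_product_sums[OF sn sn] by (simp add: k_def)
  moreover have "(\<lambda>n. ((1::real) gchoose n) *\<^sub>R (- h) ^ n) sums
      (\<Sum>n\<in>{0,1}. ((1::real) gchoose n) *\<^sub>R (- h) ^ n)"
  proof (rule sums_finite)
    fix n :: nat assume "n \<notin> {0,1}"
    hence "n > 1" by simp
    moreover have "(1::real) gchoose n = of_nat (1 choose n)"
      using binomial_gbinomial[of 1 n, where 'a = real] by simp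
    ultimately show "((1::real) gchoose n) *\<^sub>R (- h) ^ n = 0"
      by (simp add: binomial_eq_0)
  qed simp
  ultimately have 2: "k * k = 1 - h"
    by (auto dest: sums_unique2)
  have 3: "x * k = k * x" if "x * h = h * x" for x
  proof -
    have "x * (- h) ^ n = (- h) ^ n * x" for n
      by (rule power_commuting_commutes[symmetric]) (simp add: that)
    hence "x * f n = f n * x" for n by (simp add: f_def)
    thus ?thesis unfolding k_def
      by (metis (no_types, lifting) s suminf_cong suminf_mult suminf_mult2)
  qed
  show thesis using that 1 2 3 by blast
qed

section \<open>The trace and its L2-norm\<close>

locale cstar_state =
  fixes \<tau> :: "'a::cstar_algebra \<Rightarrow> complex"
  assumes faithful_tracial: "faithful_tracial_state \<tau>"
begin

lemma tau_add: "\<tau> (x + y) = \<tau> x + \<tau> y"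
  and tau_scaleC: "\<tau> (scaleC c x) = c * \<tau> x"
  and tau_one: "\<tau> 1 = 1"
  and tau_pos: "Re (\<tau> (adj x * x)) \<ge> 0"
  and tau_Im: "Im (\<tau> (adj x * x)) = 0"
  and tau_faithful: "\<tau> (adj x * x) = 0 \<Longrightarrow> x = 0"
  using faithful_tracial unfolding faithful_tracial_state_def by auto

lemma tau_scaleR: "\<tau> (r *\<^sub>R x) = r * \<tau> x"
  using tau_scaleC[of "of_real r" x] by (simp add: scaleC_of_real)

lemma tau_zero: "\<tau> 0 = 0"
  using tau_scaleR[of 0 0] by simp

lemma tau_diff: "\<tau> (x - y) = \<tau> x - \<tau> y"
  using tau_add[of x "-1 *\<^sub>R y"] tau_scaleR[of "-1" y] by simp

lemma tau_sum: "\<tau> (\<Sum>i\<in>I. f i) = (\<Sum>i\<in>I. \<tau> (f i))"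
  by (induction I rule: infinite_finite_induct) (simp_all add: tau_add tau_zero)

text \<open>For N above the square of \<open>norm x\<close>, the element N -
  \<open>adj x * x\<close> is N k^2 with k self-adjoint. Positivity at \<open>k * y\<close> gives
  the bound with factor N, and then N decreases to the squared norm.\<close>

lemma tau_left_mult_le:
  "Re (\<tau> (adj (x * y) * (x * y))) \<le> (norm x)\<^sup>2 * Re (\<tau> (adj y * y))"
proof -
  have *: "Re (\<tau> (adj (x * y) * (x * y))) \<le> N * Re (\<tau> (adj y * y))" if N: "N > (norm x)\<^sup>2" for N
  proof -
    have N0: "N > 0" using N by (meson le_less_trans zero_le_power2)
    define h where "h = (1/N) *\<^sub>R (adj x * x)"
    have "norm h < 1" using N N0 by (simp add: h_def cstar_identity power2_eq_square)
    moreover have "adj h = h" by (simp add: h_def adj_scaleR adj_mult adj_adj)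
    ultimately obtain k where k: "adj k = k" "k * k = 1 - h"
      using selfadjoint_sqrt_one_minus by metis
    have "adj (k * y) * (k * y) = adj y * (k * k) * y"
      by (simp add: adj_mult k(1) mult.assoc)
    also have "\<dots> = adj y * y - (1/N) *\<^sub>R (adj (x * y) * (x * y))"
      by (simp add: k(2) h_def adj_mult algebra_simps)
    finally have "0 \<le> Re (\<tau> (adj y * y)) - Re (\<tau> (adj (x * y) * (x * y))) / N"
      using tau_pos[of "k * y"] by (simp add: tau_diff tau_scaleR)
    thus ?thesis using N0 by (simp add: field_simps)
  qed
  have "((\<lambda>N. N * Re (\<tau> (adj y * y))) \<longlongrightarrow> (norm x)\<^sup>2 * Re (\<tau> (adj y * y))) (at_right ((norm x)\<^sup>2))"
    by (intro tendsto_intros)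
  thus ?thesis
    by (rule tendsto_lowerbound) (use * in \<open>auto simp: eventually_at_right_less eventually_at_filter\<close>)
qed

text \<open>The parallelogram law, with the nonnegative term of \<open>x - y\<close>
  dropped.\<close>

lemma tau_square_add_le:
  "Re (\<tau> (adj (x + y) * (x + y))) \<le> 2 * Re (\<tau> (adj x * x)) + 2 * Re (\<tau> (adj y * y))"
proof -
  have "adj (x + y) * (x + y) + adj (x - y) * (x - y) = 2 *\<^sub>R (adj x * x) + 2 *\<^sub>R (adj y * y)"
    by (simp add: adj_add adj_diff algebra_simps scaleR_2)
  hence "Re (\<tau> (adj (x + y) * (x + y) + adj (x - y) * (x - y)))
       = Re (\<tau> (2 *\<^sub>R (adj x * x) + 2 *\<^sub>R (adj y * y)))"
    by (rule arg_cong)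
  hence "Re (\<tau> (adj (x + y) * (x + y))) + Re (\<tau> (adj (x - y) * (x - y)))
       = 2 * Re (\<tau> (adj x * x)) + 2 * Re (\<tau> (adj y * y))"
    by (simp only: tau_add tau_scaleR) simp
  thus ?thesis using tau_pos[of "x - y"] by linarith
qed

end

section \<open>Polynomial functional calculus\<close>

definition alg_poly :: "'a::real_normed_algebra_1 \<Rightarrow> real poly \<Rightarrow> 'a" where
  "alg_poly x p = (\<Sum>i\<le>degree p. coeff p i *\<^sub>R x ^ i)"

lemma alg_poly_altdef:
  assumes "degree p \<le> n"
  shows "alg_poly x p = (\<Sum>i\<le>n. coeff p i *\<^sub>R x ^ i)"
  unfolding alg_poly_def
  by (rule sum.mono_neutral_left) (use assms in \<open>auto simp: coeff_eq_0\<close>)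

lemma alg_poly_0 [simp]: "alg_poly x 0 = 0"
  by (simp add: alg_poly_def)

lemma alg_poly_add: "alg_poly x (p + q) = alg_poly x p + alg_poly x q"
proof -
  define n where "n = max (degree p) (degree q)"
  have "degree (p + q) \<le> n" unfolding n_def by (rule degree_add_le_max)
  thus ?thesis
    by (simp add: alg_poly_altdef[of _ n] n_def sum.distrib algebra_simps)
qed

lemma alg_poly_smult: "alg_poly x (smult c p) = c *\<^sub>R alg_poly x p"
  by (cases "c = 0") (simp_all add: alg_poly_def scaleR_sum_right)

lemma alg_poly_minus: "alg_poly x (- p) = - alg_poly x p"
  using alg_poly_smult[of x "-1" p] by simp

lemma alg_poly_diff: "alg_poly x (p - q) = alg_poly x p - alg_poly x q"
  using alg_poly_add[of x p "- q"] by (simp add: alg_poly_minus)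

lemma alg_poly_pCons: "alg_poly x (pCons c p) = c *\<^sub>R 1 + x * alg_poly x p"
proof -
  have "alg_poly x (pCons c p) = (\<Sum>i\<le>Suc (degree p). coeff (pCons c p) i *\<^sub>R x ^ i)"
    by (rule alg_poly_altdef) (rule degree_pCons_le)
  also have "\<dots> = c *\<^sub>R 1 + (\<Sum>i\<le>degree p. coeff p i *\<^sub>R x ^ Suc i)"
    by (subst sum.atMost_Suc_shift) simp
  also have "(\<Sum>i\<le>degree p. coeff p i *\<^sub>R x ^ Suc i) = x * alg_poly x p"
    by (simp add: alg_poly_def sum_distrib_left)
  finally show ?thesis .
qed

lemma alg_poly_1 [simp]: "alg_poly x 1 = 1"
  by (simp add: one_pCons alg_poly_pCons)

lemma alg_poly_mult: "alg_poly x (p * q) = alg_poly x p * alg_poly x q"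
proof (induction p)
  case (pCons c p)
  have "alg_poly x (pCons c p * q) = c *\<^sub>R alg_poly x q + x * alg_poly x (p * q)"
    by (simp add: mult_pCons_left alg_poly_add alg_poly_smult alg_poly_pCons)
  thus ?case by (simp add: pCons alg_poly_pCons algebra_simps)
qed simp

lemma alg_poly_power: "alg_poly x (p ^ n) = alg_poly x p ^ n"
  by (induction n) (simp_all add: alg_poly_mult)

lemma alg_poly_sum: "alg_poly x (\<Sum>i\<in>I. f i) = (\<Sum>i\<in>I. alg_poly x (f i))"
  by (induction I rule: infinite_finite_induct) (simp_all add: alg_poly_add)

lemma alg_poly_pcompose_scale: "alg_poly x (pcompose p [:0, c:]) = alg_poly (c *\<^sub>R x) p"
  by (induction p) (simp_all add: pcompose_pCons alg_poly_add alg_poly_smult alg_poly_pCons)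

lemma alg_poly_commute: "x * y = y * x \<Longrightarrow> alg_poly x p * y = y * alg_poly x p"
  by (induction p) (simp_all add: alg_poly_pCons algebra_simps, metis mult.assoc)

lemma adj_alg_poly: "adj x = x \<Longrightarrow> adj (alg_poly x p) = alg_poly x (p :: real poly)"
  by (simp add: alg_poly_def adj_sum adj_scaleR adj_power)

text \<open>Chebyshev polynomials of both kinds, generated by \<open>(x + \<i> \<surd>(1 - x\<^sup>2))\<^sup>n = T\<^sub>n + \<i> \<surd>(1 - x\<^sup>2) V\<^sub>n\<close>.\<close>

fun chebT :: "nat \<Rightarrow> real poly" and chebV :: "nat \<Rightarrow> real poly" where
  "chebT 0 = 1"
| "chebV 0 = 0"
| "chebT (Suc n) = [:0, 1:] * chebT n - [:1, 0, -1:] * chebV n"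
| "chebV (Suc n) = [:0, 1:] * chebV n + chebT n"

text \<open>The polynomial form of cos^2 + sin^2 = 1, a Pell equation. For n \<ge> 1,
  \<open>chebV n\<close> is the Chebyshev polynomial of the second kind of degree n - 1.\<close>

lemma cheb_pell: "chebT n * chebT n + [:1, 0, -1:] * (chebV n * chebV n) = 1"
proof (induction n)
  case (Suc n)
  have sq: "[:0, 1:] * [:0, 1:] = 1 - [:1, 0, -1::real:]" by (simp add: one_pCons)
  \<comment> \<open>The form t^2 + w v^2 is multiplicative; with w = 1 - x^2 the factor x^2 + w is
    1.\<close>
  have "(x * t - w * v) * (x * t - w * v) + w * ((x * v + t) * (x * v + t))
      = (x * x + w) * (t * t + w * (v * v))" for x t w v :: "real poly"
    by (simp add: algebra_simps)
  thus ?case unfolding chebT.simps chebV.simps by (simp only: Suc sq) simp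
qed simp

lemma poly_cheb_cos:
  "poly (chebT n) (cos t) = cos (real n * t)"
  "poly (chebV n) (cos t) * sin t = sin (real n * t)"
proof (induction n)
  case (Suc n)
  { case 1
    have "poly [:1, 0, -1:] (cos t) = sin t * sin t"
      using sin_cos_squared_add[of t] by (simp add: power2_eq_square)
    hence "poly (chebT (Suc n)) (cos t) =
        cos t * poly (chebT n) (cos t) - sin t * (poly (chebV n) (cos t) * sin t)"
      unfolding chebT.simps poly_diff poly_mult by simp
    thus ?case using Suc by (simp add: distrib_right cos_add) }
  { case 2
    have "poly (chebV (Suc n)) (cos t) * sin t =
        cos t * (poly (chebV n) (cos t) * sin t) + sin t * poly (chebT n) (cos t)"
      by (simp add: algebra_simps)
    thus ?case using Suc by (simp add: distrib_right sin_add) }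
qed simp_all

text \<open>The recursions are coupled, so one induction carries all four claims. The nonzero
  leading coefficient of \<open>chebT\<close> is what the expansion below divides by.\<close>

lemma cheb_degree_coeff:
  "degree (chebT (Suc n)) \<le> Suc n \<and> degree (chebV (Suc n)) \<le> n \<and>
   coeff (chebT (Suc n)) (Suc n) = 2 ^ n \<and> coeff (chebV (Suc n)) n = 2 ^ n"
proof (induction n)
  case (Suc n)
  have co: "coeff ([:1, 0, -1:] * p) (Suc (Suc m)) = coeff p (Suc (Suc m)) - coeff p m"
     for p :: "real poly" and m by (simp add: mult_pCons_left)
  have T: "degree (chebT (Suc (Suc n))) \<le> Suc (Suc n)"
  proof (rule degree_le, intro allI impI)
    fix i assume "Suc (Suc n) < i"
    then obtain m where m: "i = Suc (Suc m)" "n < m" by (metis Suc_less_eq2)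
    have "chebT (Suc (Suc n)) = [:0, 1:] * chebT (Suc n) - [:1, 0, -1:] * chebV (Suc n)"
      by (rule chebT.simps(2))
    thus "coeff (chebT (Suc (Suc n))) i = 0" using Suc m
      by (simp only: coeff_diff co) (simp del: chebT.simps chebV.simps add: coeff_eq_0)
  qed
  have V: "degree (chebV (Suc (Suc n))) \<le> Suc n"
  proof (rule degree_le, intro allI impI)
    fix i assume "Suc n < i"
    then obtain m where m: "i = Suc m" "n < m" by (metis Suc_less_eq2)
    have "chebV (Suc (Suc n)) = [:0, 1:] * chebV (Suc n) + chebT (Suc n)"
      by (rule chebV.simps(2))
    thus "coeff (chebV (Suc (Suc n))) i = 0" using Suc m
      by (simp del: chebT.simps chebV.simps add: coeff_eq_0)
  qed
  have "chebT (Suc (Suc n)) = [:0, 1:] * chebT (Suc n) - [:1, 0, -1:] * chebV (Suc n)"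
    by (rule chebT.simps(2))
  hence T2: "coeff (chebT (Suc (Suc n))) (Suc (Suc n)) = 2 ^ Suc n" using Suc
    by (simp only: coeff_diff co) (simp del: chebT.simps chebV.simps add: coeff_eq_0)
  have "chebV (Suc (Suc n)) = [:0, 1:] * chebV (Suc n) + chebT (Suc n)"
    by (rule chebV.simps(2))
  hence V2: "coeff (chebV (Suc (Suc n))) (Suc n) = 2 ^ Suc n" using Suc
    by (simp del: chebT.simps chebV.simps add: coeff_eq_0)
  show ?case using T V T2 V2 by blast
qed (simp_all add: one_pCons)

text \<open>Subtracting the multiple of \<open>chebT (Suc d)\<close> that matches the top
  coefficient lowers the degree.\<close>

lemma chebT_expansion:
  assumes "degree p \<le> d"
  obtains a where "p = (\<Sum>n\<le>d. smult (a n) (chebT n))"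
  using assms
proof (induction d arbitrary: p thesis)
  case 0
  hence "p = smult (coeff p 0) (chebT 0)"
    by (metis chebT.simps(1) degree_0_id le_zero_eq mult.right_neutral one_pCons smult_0_right smult_pCons)
  thus ?case using 0(1)[of "\<lambda>_. coeff p 0"] by simp
next
  case (Suc d)
  define c where "c = coeff p (Suc d) / 2 ^ d"
  define q where "q = p - smult c (chebT (Suc d))"
  have "degree q \<le> d"
  proof (rule degree_le, intro allI impI)
    fix i assume "d < i"
    show "coeff q i = 0"
    proof (cases "i = Suc d")
      case True
      thus ?thesis using cheb_degree_coeff[of d]
        by (simp add: q_def c_def del: chebT.simps)
    next
      case False
      hence "i > Suc d" using \<open>d < i\<close> by simp
      thus ?thesis using cheb_degree_coeff[of d] Suc.prems(2)
        by (simp add: q_def coeff_eq_0 del: chebT.simps)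
    qed
  qed
  then obtain a where a: "q = (\<Sum>n\<le>d. smult (a n) (chebT n))" using Suc.IH by blast
  have "p = q + smult c (chebT (Suc d))" by (simp add: q_def)
  also have "\<dots> = (\<Sum>n\<le>Suc d. smult ((a(Suc d := c)) n) (chebT n))"
    by (simp add: a del: chebT.simps)
  finally show ?case by (rule Suc.prems(1))
qed

section \<open>Chebyshev coefficients and sup-norm bounds for polynomials of an element\<close>

lemma cos_mult_cos_has_integral:
  "((\<lambda>t. cos (real m * t) * cos (real n * t)) has_integral
     (if m = n then (if n = 0 then 2 * pi else pi) else 0)) {-pi..pi}"
proof -
  have "((\<lambda>t. (cos (of_int (int m + int n) * t) + cos (of_int (int m - int n) * t)) / 2)
    has_integral ((if int m + int n = 0 then 2 * pi else 0) + (if int m - int n = 0 then 2 * pi else 0)) / 2) {-pi..pi}"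
    by (intro has_integral_divide has_integral_add has_integral_cos_nx)
  moreover have "(cos (of_int (int m + int n) * t) + cos (of_int (int m - int n) * t)) / 2
      = cos (real m * t) * cos (real n * t)" for t
    by (simp add: cos_times_cos algebra_simps)
  ultimately show ?thesis by (auto split: if_splits)
qed

text \<open>With x = cos t the expansion is a cosine sum, and integrating against cos(m t) isolates
  \<open>a m * c\<close>. The integral is at most 2 pi K in modulus and c \<ge> pi, whence the
  factor 2.\<close>

lemma chebT_coeff_bound:
  assumes K: "\<And>x. \<bar>x\<bar> \<le> 1 \<Longrightarrow> \<bar>poly (\<Sum>n\<le>d. smult (a n) (chebT n)) x\<bar> \<le> K" and m: "m \<le> d"
  shows "\<bar>a m\<bar> \<le> 2 * K"
proof -
  define f where "f t = poly (\<Sum>n\<le>d. smult (a n) (chebT n)) (cos t) * cos (real m * t)" for t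
  define c where "c = (if m = 0 then 2 * pi else pi)"
  have f_eq: "f t = (\<Sum>n\<le>d. a n * (cos (real n * t) * cos (real m * t)))" for t
    by (simp add: f_def poly_sum poly_cheb_cos sum_distrib_right mult.assoc)
  have "((\<lambda>t. \<Sum>n\<le>d. a n * (cos (real n * t) * cos (real m * t))) has_integral
     (\<Sum>n\<le>d. a n * (if n = m then c else 0))) {-pi..pi}"
    unfolding c_def
    by (intro has_integral_sum has_integral_mult_right cos_mult_cos_has_integral) simp
  moreover have "(\<Sum>n\<le>d. a n * (if n = m then c else 0)) = a m * c"
    using m by (simp add: if_distrib cong: if_cong)
  ultimately have int: "(f has_integral (a m * c)) (cbox (-pi) pi)"
    unfolding f_eq[abs_def] cbox_interval by simp
  have K0: "0 \<le> K" using K[of 0] by simp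
  have "norm (a m * c) \<le> K * measure lborel (cbox (-pi) pi)"
  proof (rule has_integral_bound[OF K0 int])
    fix t :: real
    have "\<bar>f t\<bar> \<le> K * 1" unfolding f_def abs_mult
      by (rule mult_mono) (use K[of "cos t"] K0 in auto)
    thus "norm (f t) \<le> K" by simp
  qed
  hence "\<bar>a m\<bar> * c \<le> 2 * K * pi" by (simp add: abs_mult c_def split: if_splits)
  moreover have "\<bar>a m\<bar> * pi \<le> \<bar>a m\<bar> * c" by (intro mult_left_mono) (auto simp: c_def)
  ultimately have "\<bar>a m\<bar> * pi \<le> 2 * K * pi" by linarith
  thus ?thesis by simp
qed

text \<open>If b < a, dividing by a^(2^k) leaves 1 \<le> C 2^k (b/a)^(2^k), whose right side tends
  to 0. A loss linear in the exponent is therefore harmless.\<close>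

lemma le_if_powers_le_linear:
  fixes a b :: real
  assumes a: "0 \<le> a" and b: "0 \<le> b" and C: "\<And>k. a ^ (2 ^ k) \<le> C * (2 ^ k) * b ^ (2 ^ k)"
  shows "a \<le> b"
proof (rule ccontr)
  assume "\<not> a \<le> b"
  hence ab: "a > b" "a > 0" using b by auto
  have "b / a < 1" using ab by simp
  hence "(\<lambda>n. real n * (b / a) ^ n) \<longlonglongrightarrow> 0"
    using powser_times_n_limit_0[of "b / a"] b ab by simp
  hence "(\<lambda>k. real (2 ^ k) * (b / a) ^ (2 ^ k)) \<longlonglongrightarrow> 0"
    by (rule filterlim_compose[where g = "\<lambda>n. real n * (b / a) ^ n"])
       (auto intro!: filterlim_subseq simp: strict_mono_def)
  hence "(\<lambda>k. C * (real (2 ^ k) * (b / a) ^ (2 ^ k))) \<longlonglongrightarrow> C * 0"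
    by (intro tendsto_intros)
  hence "\<forall>\<^sub>F k in sequentially. C * (real (2 ^ k) * (b / a) ^ (2 ^ k)) < 1"
    by (rule order_tendstoD(2)) simp
  then obtain k where k: "C * (real (2 ^ k) * (b / a) ^ (2 ^ k)) < 1"
    by (auto simp: eventually_sequentially)
  moreover have "1 \<le> C * (real (2 ^ k) * (b / a) ^ (2 ^ k))"
    using C[of k] ab by (simp add: power_divide field_simps)
  ultimately show False by simp
qed

text \<open>As p^m is bounded by K^m on [-1, 1], each of the \<open>degree p * m + 1\<close>
  coefficients is at most 2 K^m in modulus.\<close>

lemma chebT_power_expansion:
  assumes K: "\<And>x. \<bar>x\<bar> \<le> 1 \<Longrightarrow> \<bar>poly p x\<bar> \<le> K"
  obtains a where "p ^ m = (\<Sum>n\<le>degree p * m. smult (a n) (chebT n))"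
    "(\<Sum>n\<le>degree p * m. \<bar>a n\<bar>) \<le> 2 * (real (degree p) * real m + 1) * K ^ m"
proof -
  obtain a where a: "p ^ m = (\<Sum>n\<le>degree p * m. smult (a n) (chebT n))"
    using chebT_expansion[OF degree_power_le] .
  have "\<bar>a n\<bar> \<le> 2 * K ^ m" if "n \<le> degree p * m" for n
    by (rule chebT_coeff_bound[OF _ that])
       (use K in \<open>auto simp: poly_power power_abs power_mono simp flip: a\<close>)
  hence "(\<Sum>n\<le>degree p * m. \<bar>a n\<bar>) \<le> (\<Sum>n\<le>degree p * m. 2 * K ^ m)"
    by (intro sum_mono) simp
  also have "\<dots> = 2 * (real (degree p) * real m + 1) * K ^ m"
    by (simp add: algebra_simps)
  finally show thesis using that a by blast
qed

text \<open>With k a square root of 1 - h^2, the element u = h + i k satisfies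
  \<open>adj u * u = 1\<close>, so its powers have norm at most 1; T_n(h) is the real part of
  u^n.\<close>

lemma norm_alg_poly_chebT_le:
  fixes h :: "'a::cstar_algebra"
  assumes h: "norm h < 1" and sa: "adj h = h"
  shows "norm (alg_poly h (chebT n)) \<le> 1"
proof -
  have "norm (h * h) < 1"
    using norm_mult_ineq[of h h] mult_strict_mono'[of "norm h" 1 "norm h" 1] h by simp
  moreover have "adj (h * h) = h * h" by (simp add: adj_mult sa)
  ultimately obtain k where k: "adj k = k" "k * k = 1 - h * h"
      "\<And>x. x * (h * h) = (h * h) * x \<Longrightarrow> x * k = k * x"
    using selfadjoint_sqrt_one_minus by metis
  have hk: "h * k = k * h" by (rule k(3)) (simp add: mult.assoc)
  define T V where "T m = alg_poly h (chebT m)" and "V m = alg_poly h (chebV m)" for m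
  have rec: "T (Suc m) = h * T m - k * k * V m" "V (Suc m) = h * V m + T m" for m
    by (simp_all add: T_def V_def alg_poly_diff alg_poly_add alg_poly_smult alg_poly_minus alg_poly_pCons k(2) algebra_simps)
  have V: "V m * k = k * V m" for m
    unfolding V_def by (rule alg_poly_commute) (rule hk)
  have T: "T m * k = k * T m" for m
    unfolding T_def by (rule alg_poly_commute) (rule hk)
  define u where "u = h + scaleC \<i> k"
  have adju: "adj u = h + scaleC (- \<i>) k"
    by (simp add: u_def adj_add adj_scaleC sa k(1))
  have "adj u * u = h * h + k * k"
  proof -
    have "adj u * u = (h + scaleC (- \<i>) k) * (h + scaleC \<i> k)"
      by (simp only: adju) (simp only: u_def)
    also have "\<dots> = h * h + scaleC \<i> (h * k) + scaleC (- \<i>) (k * h) + k * k"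
      by (simp add: algebra_simps mult_scaleC_left mult_scaleC_right scaleC_scaleC scaleC_add_right)
    also have "\<dots> = h * h + scaleC (\<i> + - \<i>) (h * k) + k * k"
      unfolding scaleC_add_left by (simp add: hk)
    finally show ?thesis by simp
  qed
  hence "adj u * u = 1" by (simp add: k(2))
  hence "(norm u)\<^sup>2 = 1\<^sup>2" using cstar_identity[of u] by (simp add: power2_eq_square)
  hence nu: "norm u = 1" by (rule power2_eq_imp_eq) simp_all
  \<comment> \<open>De Moivre's formula, with k in the role of the sine.\<close>
  have pow: "u ^ m = T m + scaleC \<i> (k * V m)" for m
  proof (induction m)
    case 0
    show ?case by (simp add: T_def V_def)
  next
    case (Suc m)
    have "u ^ Suc m = (h + scaleC \<i> k) * (T m + scaleC \<i> (k * V m))"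
      by (simp only: power_Suc Suc) (simp only: u_def)
    also have "\<dots> = h * T m + scaleC \<i> (h * k * V m + k * T m) + scaleC (-1) (k * k * V m)"
      by (simp add: algebra_simps mult_scaleC_left mult_scaleC_right scaleC_scaleC scaleC_add_right)
    also have "\<dots> = T (Suc m) + scaleC \<i> (k * V (Suc m))"
      by (simp add: rec scaleC_minus_one hk algebra_simps mult.assoc)
    finally show ?case .
  qed
  have "norm (u ^ n) \<le> 1" using norm_power_ineq[of u n] nu by simp
  moreover have "2 *\<^sub>R T n = u ^ n + adj (u ^ n)"
  proof -
    have "adj (T n) = T n" "adj (V n) = V n" using sa by (simp_all add: T_def V_def adj_alg_poly)
    hence "adj (u ^ n) = T n + scaleC (- \<i>) (k * V n)"
      by (simp add: pow adj_add adj_scaleC adj_mult k(1) V)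
    hence "u ^ n + adj (u ^ n) = 2 *\<^sub>R T n + scaleC (\<i> + - \<i>) (k * V n)"
      unfolding scaleC_add_left by (simp add: pow scaleR_2)
    thus ?thesis by simp
  qed
  ultimately have "norm (2 *\<^sub>R T n) \<le> 2"
    using norm_triangle_ineq[of "u ^ n" "adj (u ^ n)"] by simp
  thus ?thesis by (simp add: T_def)
qed

text \<open>After rescaling to the unit interval, the powers q^(2^k) are expanded in Chebyshev
  polynomials, each of norm at most 1 at h. The linear loss disappears on taking roots. Strictness
  of \<open>norm x < N\<close> makes h a strict contraction, as the square root requires.\<close>

lemma norm_alg_poly_le:
  fixes x :: "'a::cstar_algebra"
  assumes x: "norm x < N" and sa: "adj x = x" and K: "\<And>t. \<bar>t\<bar> \<le> N \<Longrightarrow> \<bar>poly p t\<bar> \<le> K"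
  shows "norm (alg_poly x p) \<le> K"
proof -
  have N: "N > 0" using x by (meson le_less_trans norm_ge_zero)
  define h where "h = (1/N) *\<^sub>R x"
  define q where "q = pcompose p [:0, N:]"
  have q: "alg_poly x p = alg_poly h q" using N by (simp add: q_def h_def alg_poly_pcompose_scale)
  have h: "norm h < 1" "adj h = h" using x N by (simp_all add: h_def adj_scaleR sa)
  have Kq: "\<bar>poly q t\<bar> \<le> K" if "\<bar>t\<bar> \<le> 1" for t
    unfolding q_def poly_pcompose by (rule K) (use that N in \<open>simp add: abs_mult\<close>)
  have K0: "0 \<le> K" using Kq[of 0] by simp
  have "norm (alg_poly h q) \<le> K"
  proof (rule le_if_powers_le_linear[where C = "2 * (real (degree q) + 1)"])
    fix k :: nat
    obtain a where a: "q ^ (2 ^ k) = (\<Sum>n\<le>degree q * 2 ^ k. smult (a n) (chebT n))"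
      "(\<Sum>n\<le>degree q * 2 ^ k. \<bar>a n\<bar>) \<le> 2 * (real (degree q) * real (2 ^ k) + 1) * K ^ (2 ^ k)"
      using chebT_power_expansion[OF Kq] by blast
    have "norm (alg_poly h q) ^ (2 ^ k) = norm (alg_poly h (q ^ (2 ^ k)))"
      unfolding alg_poly_power
      by (rule norm_power_two_selfadjoint[symmetric]) (simp add: adj_alg_poly h)
    also have "\<dots> \<le> (\<Sum>n\<le>degree q * 2 ^ k. \<bar>a n\<bar>)"
      unfolding a(1) alg_poly_sum alg_poly_smult
      by (rule sum_norm_le) (use norm_alg_poly_chebT_le[OF h] in \<open>auto intro: mult_left_le\<close>)
    also have "\<dots> \<le> 2 * (real (degree q) * real (2 ^ k) + 1) * K ^ (2 ^ k)" by (rule a(2))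
    also have "\<dots> \<le> 2 * (real (degree q) + 1) * 2 ^ k * K ^ (2 ^ k)"
      using K0 by (intro mult_right_mono) (simp_all add: algebra_simps)
    finally show "norm (alg_poly h q) ^ (2 ^ k) \<le> 2 * (real (degree q) + 1) * 2 ^ k * K ^ (2 ^ k)" .
  qed (simp_all add: K0)
  thus ?thesis by (simp add: q)
qed

text \<open>The same power trick, with Cauchy-Schwarz in place of the C*-identity.\<close>

lemma positive_functional_poly_square_le:
  fixes \<phi> :: "real poly \<Rightarrow> real"
  assumes add: "\<And>p q. \<phi> (p + q) = \<phi> p + \<phi> q" and smult: "\<And>c p. \<phi> (smult c p) = c * \<phi> p"
    and pos: "\<And>p. \<phi> (p * p) \<ge> 0" and one: "\<phi> 1 = 1"
    and contr: "\<And>p. \<phi> (([:0, 1:] * p) * ([:0, 1:] * p)) \<le> \<phi> (p * p)"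
    and K: "\<And>x. \<bar>x\<bar> \<le> 1 \<Longrightarrow> \<bar>poly p x\<bar> \<le> K"
  shows "\<phi> (p * p) \<le> K\<^sup>2"
proof -
  have minus: "\<phi> (- p) = - \<phi> p" for p using smult[of "-1" p] by simp
  have diff: "\<phi> (p - q) = \<phi> p - \<phi> q" for p q using add[of p "-q"] by (simp add: minus)
  have zero: "\<phi> 0 = 0" using smult[of 0 0] by simp
  have sum: "\<phi> (\<Sum>i\<in>I. f i) = (\<Sum>i\<in>I. \<phi> (f i))" for I :: "nat set" and f
    by (induction I rule: infinite_finite_induct) (simp_all add: add zero)
  \<comment> \<open>The Pell equation and \<open>contr\<close> give \<phi>(T^2) \<le> 1; positivity
    at T - 1 and T + 1 then bounds \<phi>(T) from both sides.\<close>
  have T: "\<bar>\<phi> (chebT n)\<bar> \<le> 1" for n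
  proof -
    have "chebT n * chebT n + chebV n * chebV n - ([:0,1:] * chebV n) * ([:0,1:] * chebV n) = 1"
      by (subst cheb_pell[symmetric, of n]) simp
    hence "\<phi> (chebT n * chebT n) + \<phi> (chebV n * chebV n)
        - \<phi> (([:0,1:] * chebV n) * ([:0,1:] * chebV n)) = 1"
      by (metis add diff one)
    hence 1: "\<phi> (chebT n * chebT n) \<le> 1" using contr[of "chebV n"] by linarith
    have "\<phi> ((chebT n - 1) * (chebT n - 1)) = \<phi> (chebT n * chebT n - (chebT n + chebT n) + 1)"
      by (rule arg_cong[of _ _ \<phi>]) (simp add: algebra_simps)
    hence "\<phi> ((chebT n - 1) * (chebT n - 1)) = \<phi> (chebT n * chebT n) - 2 * \<phi> (chebT n) + 1"
      unfolding add diff one by linarith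
    moreover have "\<phi> ((chebT n + 1) * (chebT n + 1)) = \<phi> (chebT n * chebT n + (chebT n + chebT n) + 1)"
      by (rule arg_cong[of _ _ \<phi>]) (simp add: algebra_simps)
    hence "\<phi> ((chebT n + 1) * (chebT n + 1)) = \<phi> (chebT n * chebT n) + 2 * \<phi> (chebT n) + 1"
      unfolding add diff one by linarith
    ultimately show ?thesis using 1 pos[of "chebT n - 1"] pos[of "chebT n + 1"] by linarith
  qed
  \<comment> \<open>Cauchy-Schwarz against 1: positivity at q minus the constant \<phi>(q), its
    projection onto the constants.\<close>
  have cs: "(\<phi> q)\<^sup>2 \<le> \<phi> (q * q)" for q
  proof -
    have sq: "(q - smult c 1) * (q - smult c 1) = q * q - (smult c q + smult c q) + smult (c * c) 1" for c
    proof -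
      have "(q - t) * (q - t) = q * q - (t * q + t * q) + t * t" for t
        by (simp add: algebra_simps)
      from this[of "smult c 1"] show ?thesis by (simp add: one_pCons)
    qed
    have "\<phi> ((q - smult (\<phi> q) 1) * (q - smult (\<phi> q) 1)) = \<phi> (q * q) - \<phi> q * \<phi> q"
      unfolding sq
      by (simp only: add diff smult one)
    thus ?thesis using pos[of "q - smult (\<phi> q) 1"] by (simp add: power2_eq_square)
  qed
  define q where "q = p * p"
  have iter: "\<phi> q ^ (2 ^ k) \<le> \<phi> (q ^ (2 ^ k))" for k
  proof (induction k)
    case (Suc k)
    have "\<phi> q ^ (2 ^ Suc k) = (\<phi> q ^ (2 ^ k))\<^sup>2" by (simp add: power_mult mult.commute flip: power_mult)
    also have "\<dots> \<le> (\<phi> (q ^ (2 ^ k)))\<^sup>2"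
      using Suc pos[of p] by (intro power_mono) (simp_all add: q_def)
    also have "\<dots> \<le> \<phi> (q ^ (2 ^ Suc k))"
      using cs[of "q ^ (2 ^ k)"] by (simp add: mult_2 power_add)
    finally show ?case .
  qed simp
  have Kq: "\<bar>poly q x\<bar> \<le> K\<^sup>2" if "\<bar>x\<bar> \<le> 1" for x
    unfolding q_def power2_eq_square poly_mult abs_mult
    using K[OF that] by (intro mult_mono) auto
  have "\<phi> q \<le> K\<^sup>2"
  proof (rule le_if_powers_le_linear[where C = "2 * (real (degree q) + 1)"])
    fix k :: nat
    obtain a where a: "q ^ (2 ^ k) = (\<Sum>n\<le>degree q * 2 ^ k. smult (a n) (chebT n))"
      "(\<Sum>n\<le>degree q * 2 ^ k. \<bar>a n\<bar>) \<le> 2 * (real (degree q) * real (2 ^ k) + 1) * (K\<^sup>2) ^ (2 ^ k)"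
      using chebT_power_expansion[OF Kq] by blast
    have "\<phi> q ^ (2 ^ k) \<le> \<phi> (q ^ (2 ^ k))" by (rule iter)
    also have "\<dots> \<le> (\<Sum>n\<le>degree q * 2 ^ k. \<bar>a n\<bar>)"
      unfolding a(1) sum smult
    proof (rule sum_mono)
      fix n
      have "a n * \<phi> (chebT n) \<le> \<bar>a n\<bar> * \<bar>\<phi> (chebT n)\<bar>" by (metis abs_ge_self abs_mult)
      also have "\<dots> \<le> \<bar>a n\<bar> * 1" by (intro mult_left_mono T) simp
      finally show "a n * \<phi> (chebT n) \<le> \<bar>a n\<bar>" by simp
    qed
    also have "\<dots> \<le> 2 * (real (degree q) * real (2 ^ k) + 1) * (K\<^sup>2) ^ (2 ^ k)" by (rule a(2))
    also have "\<dots> \<le> 2 * (real (degree q) + 1) * 2 ^ k * (K\<^sup>2) ^ (2 ^ k)"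
      by (intro mult_right_mono) (simp_all add: algebra_simps)
    finally show "\<phi> q ^ (2 ^ k) \<le> 2 * (real (degree q) + 1) * 2 ^ k * (K\<^sup>2) ^ (2 ^ k)" .
  qed (use pos[of p] in \<open>simp_all add: q_def\<close>)
  thus ?thesis by (simp add: q_def)
qed

lemma polynomial_approx:
  fixes f :: "real \<Rightarrow> real"
  assumes "continuous_on {-N..N} f" "e > 0"
  obtains p where "\<And>x. \<bar>x\<bar> \<le> N \<Longrightarrow> \<bar>f x - poly p x\<bar> < e"
proof -
  obtain g where g: "real_polynomial_function g" "\<And>x. x \<in> {-N..N} \<Longrightarrow> \<bar>f x - g x\<bar> < e"
    using Stone_Weierstrass_real_polynomial_function[OF compact_Icc assms] by blast
  then obtain a n where "g = (\<lambda>x. \<Sum>i\<le>n. a i * x ^ i)"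
    by (auto simp: real_polynomial_function_iff_sum)
  hence "g x = poly (\<Sum>i\<le>n. monom (a i) i) x" for x
    by (simp add: poly_sum poly_monom)
  thus thesis using g(2) by (intro that[of "\<Sum>i\<le>n. monom (a i) i"]) (auto simp: abs_le_iff)
qed

section \<open>From L2-bounds to norm bounds\<close>

context cstar_state
begin

text \<open>The preceding bound applies to the functional q \<mapsto> Re \<tau>(q(x/M)). In effect
  the distribution of \<open>x\<close> lives on [-M, M], so only the values of p there count in
  L2.\<close>

lemma tau_alg_poly_square_le:
  fixes x :: 'a
  assumes M: "M > 0" and sa: "adj x = x"
    and contr: "\<And>p. Re (\<tau> ((x * alg_poly x p) * (x * alg_poly x p))) \<le> M\<^sup>2 * Re (\<tau> (alg_poly x p * alg_poly x p))"
    and K: "\<And>t. \<bar>t\<bar> \<le> M \<Longrightarrow> \<bar>poly p t\<bar> \<le> K"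
  shows "Re (\<tau> (alg_poly x p * alg_poly x p)) \<le> K\<^sup>2"
proof -
  define h where "h = (1/M) *\<^sub>R x"
  have x: "x = M *\<^sub>R h" using M by (simp add: h_def)
  have sah: "adj h = h" by (simp add: h_def adj_scaleR sa)
  define \<phi> where "\<phi> q = Re (\<tau> (alg_poly h q))" for q
  have "\<phi> (pcompose p [:0, M:] * pcompose p [:0, M:]) \<le> K\<^sup>2"
  proof (rule positive_functional_poly_square_le)
    show "0 \<le> \<phi> (q * q)" for q
      using tau_pos[of "alg_poly h q"] by (simp add: \<phi>_def alg_poly_mult adj_alg_poly sah)
    show "\<phi> ([:0, 1:] * q * ([:0, 1:] * q)) \<le> \<phi> (q * q)" for q
    proof -
      have q: "alg_poly h q = alg_poly x (pcompose q [:0, 1/M:])"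
        by (simp add: alg_poly_pcompose_scale h_def)
      have "M\<^sup>2 * \<phi> ([:0, 1:] * q * ([:0, 1:] * q)) = Re (\<tau> ((x * alg_poly h q) * (x * alg_poly h q)))"
        by (simp add: \<phi>_def alg_poly_mult alg_poly_pCons x tau_scaleR power2_eq_square del: mult_pCons_left)
      also have "\<dots> \<le> M\<^sup>2 * \<phi> (q * q)"
        unfolding q by (rule order_trans[OF contr]) (simp add: \<phi>_def alg_poly_mult q)
      finally show ?thesis using M by simp
    qed
    show "\<bar>poly (pcompose p [:0, M:]) t\<bar> \<le> K" if "\<bar>t\<bar> \<le> 1" for t
      unfolding poly_pcompose by (rule K) (use that M in \<open>simp add: abs_mult\<close>)
  qed (simp_all add: \<phi>_def alg_poly_add alg_poly_smult tau_add tau_scaleR tau_one)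
  thus ?thesis by (simp add: \<phi>_def alg_poly_mult alg_poly_pcompose_scale x)
qed

text \<open>Polynomials approximating the truncation of \<open>t\<close> to \<open>[-M, M]\<close> converge in norm at \<open>x\<close>;
  the limit coincides with \<open>x\<close> in the \<open>L\<^sup>2\<close>-norm of the trace, hence by faithfulness.\<close>

lemma norm_le_if_L2_contraction:
  fixes x :: 'a
  assumes M: "M > 0" and sa: "adj x = x"
    and contr: "\<And>p. Re (\<tau> ((x * alg_poly x p) * (x * alg_poly x p))) \<le> M\<^sup>2 * Re (\<tau> (alg_poly x p * alg_poly x p))"
  shows "norm x \<le> M"
proof (cases "M \<le> norm x")
  case True
  \<comment> \<open>N is strictly above \<open>norm x\<close>, as the norm bounds require, and M
    \<le> N in this case, so the approximation also covers [-M, M].\<close>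
  define N where "N = norm x + 1"
  define f where "f t = max (-M) (min M t)" for t :: real
  have "continuous_on {-N..N} f" unfolding f_def by (intro continuous_intros)
  hence "\<exists>p. \<forall>t. \<bar>t\<bar> \<le> N \<longrightarrow> \<bar>f t - poly p t\<bar> < 1 / real (Suc n)" for n
    by (rule polynomial_approx[where e = "1 / real (Suc n)"]) auto
  then obtain p where p: "\<And>n t. \<bar>t\<bar> \<le> N \<Longrightarrow> \<bar>f t - poly (p n) t\<bar> < 1 / real (Suc n)" by metis
  define y where "y n = alg_poly x (p n)" for n
  have y_sa: "adj (y n) = y n" for n by (simp add: y_def adj_alg_poly sa)
  have xN: "norm x < N" by (simp add: N_def)
  have inv: "(\<lambda>n. 1 / real (Suc n)) \<longlonglongrightarrow> 0" using LIMSEQ_inverse_real_of_nat by (simp add: inverse_eq_divide)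
  have bound: "norm (y n) \<le> M + 1 / real (Suc n)" for n
    unfolding y_def
  proof (rule norm_alg_poly_le[OF xN sa])
    fix t assume "\<bar>t\<bar> \<le> N"
    moreover have "\<bar>f t\<bar> \<le> M" using M by (auto simp: f_def)
    ultimately show "\<bar>poly (p n) t\<bar> \<le> M + 1 / real (Suc n)" using p[of t n] by linarith
  qed
  have dist: "norm (y m - y n) \<le> 1 / real (Suc m) + 1 / real (Suc n)" for m n
    unfolding y_def alg_poly_diff[symmetric]
  proof (rule norm_alg_poly_le[OF xN sa])
    fix t assume "\<bar>t\<bar> \<le> N"
    thus "\<bar>poly (p m - p n) t\<bar> \<le> 1 / real (Suc m) + 1 / real (Suc n)"
      using p[of t m] p[of t n] by simp
  qed
  have "Cauchy y"
  proof (rule CauchyI)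
    fix e :: real assume "e > 0"
    then obtain n0 where n0: "\<And>n. n \<ge> n0 \<Longrightarrow> 1 / real (Suc n) < e / 2"
      using order_tendstoD(2)[OF inv, of "e/2"] by (auto simp: eventually_sequentially)
    have "norm (y m - y n) < e" if "m \<ge> n0" "n \<ge> n0" for m n
      using dist[of m n] n0[OF that(1)] n0[OF that(2)] by linarith
    thus "\<exists>M. \<forall>m\<ge>M. \<forall>n\<ge>M. norm (y m - y n) < e" by blast
  qed
  then obtain z where z: "y \<longlonglongrightarrow> z" using Cauchy_convergent convergent_def by blast
  have zM: "norm z \<le> M"
  proof (rule LIMSEQ_le[OF tendsto_norm[OF z]])
    show "(\<lambda>n. M + 1 / real (Suc n)) \<longlonglongrightarrow> M" using tendsto_add[OF tendsto_const inv, of M] by simp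
  qed (use bound in auto)
  define e where "e n = 2 * (1 / real (Suc n))\<^sup>2 + 2 * (norm (y n - z))\<^sup>2" for n
  have "Re (\<tau> (adj (x - z) * (x - z))) \<le> e n" for n
  proof -
    \<comment> \<open>In L2 only [-M, M] matters, where the truncation is the identity; the norm
      bounds above needed all of [-N, N], where it is merely bounded by M.\<close>
    define q where "q = [:0, 1:] - p n"
    have q: "x - y n = alg_poly x q" by (simp add: q_def alg_poly_diff alg_poly_pCons y_def)
    have "Re (\<tau> (alg_poly x q * alg_poly x q)) \<le> (1 / real (Suc n))\<^sup>2"
    proof (rule tau_alg_poly_square_le[OF M sa contr])
      fix t assume t: "\<bar>t\<bar> \<le> M"
      hence "f t = t" by (auto simp: f_def)
      thus "\<bar>poly q t\<bar> \<le> 1 / real (Suc n)"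
        using p[of t n] t True by (simp add: q_def N_def)
    qed
    hence 1: "Re (\<tau> (adj (x - y n) * (x - y n))) \<le> (1 / real (Suc n))\<^sup>2"
      by (simp add: q adj_alg_poly sa)
    \<comment> \<open>The norm dominates the L2-norm: left multiplication is applied to 1.\<close>
    have 2: "Re (\<tau> (adj (y n - z) * (y n - z))) \<le> (norm (y n - z))\<^sup>2"
      using tau_left_mult_le[of "y n - z" 1] by (simp add: tau_one)
    show ?thesis
      using tau_square_add_le[of "x - y n" "y n - z"] 1 2 by (simp add: e_def)
  qed
  moreover have "e \<longlonglongrightarrow> 2 * 0\<^sup>2 + 2 * (norm (z - z))\<^sup>2"
    unfolding e_def by (intro tendsto_intros inv z)
  ultimately have "Re (\<tau> (adj (x - z) * (x - z))) \<le> 2 * 0\<^sup>2 + 2 * (norm (z - z))\<^sup>2"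
    by (intro LIMSEQ_le_const) auto
  hence "\<tau> (adj (x - z) * (x - z)) = 0"
    using tau_pos[of "x - z"] tau_Im[of "x - z"] by (simp add: complex_eq_iff)
  hence "x - z = 0" by (rule tau_faithful)
  thus ?thesis using zM by simp
qed simp

end

section \<open>The trace monoid\<close>

definition tm_equiv :: "(nat \<Rightarrow> nat \<Rightarrow> bool) \<Rightarrow> nat list \<Rightarrow> nat list \<Rightarrow> bool" where
  "tm_equiv E xs ys \<longleftrightarrow> (xs, ys) \<in> (tm_swap E \<union> (tm_swap E)\<inverse>)\<^sup>*"

lemma tm_class_eq_iff: "tm_class E xs = tm_class E ys \<longleftrightarrow> tm_equiv E xs ys"
proof -
  have "sym ((tm_swap E \<union> (tm_swap E)\<inverse>)\<^sup>*)" by (intro sym_rtrancl sym_Un_converse)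
  thus ?thesis unfolding tm_class_def tm_equiv_def
    by (auto intro: rtrancl_trans dest: symD)
qed

lemma mem_tm_class: "ys \<in> tm_class E xs \<longleftrightarrow> tm_equiv E xs ys"
  by (simp add: tm_class_def tm_equiv_def)

lemma tm_equiv_refl [simp]: "tm_equiv E xs xs"
  by (simp add: tm_equiv_def)

lemma tm_equiv_sym: "tm_equiv E xs ys \<Longrightarrow> tm_equiv E ys xs"
  by (simp flip: tm_class_eq_iff)

lemma tm_equiv_trans: "tm_equiv E xs ys \<Longrightarrow> tm_equiv E ys zs \<Longrightarrow> tm_equiv E xs zs"
  by (simp flip: tm_class_eq_iff)

lemma tm_equiv_swap: "E u v \<Longrightarrow> tm_equiv E (xs @ u # v # ys) (xs @ v # u # ys)"
  unfolding tm_equiv_def tm_swap_def by (rule r_into_rtrancl) auto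

text \<open>Symmetry of \<open>E\<close> turns a backward swap into a forward one, leaving a single
  induction step.\<close>

lemma tm_equiv_induct [consumes 2, case_names refl swap]:
  assumes "tm_equiv E xs ys" and "symp E"
    and "P xs" and "\<And>as bs u v. E u v \<Longrightarrow> tm_equiv E xs (as @ u # v # bs) \<Longrightarrow> P (as @ u # v # bs) \<Longrightarrow> P (as @ v # u # bs)"
  shows "P ys"
  using assms(1) unfolding tm_equiv_def
proof (induction rule: rtrancl_induct)
  case (step y z)
  have "tm_equiv E xs y" using step(1) by (simp add: tm_equiv_def)
  moreover from step(2) obtain as bs u v where "y = as @ u # v # bs" "z = as @ v # u # bs" "E u v \<or> E v u"
    unfolding tm_swap_def by auto
  ultimately show ?case using assms(4) step.IH sympD[OF assms(2)] by metis
qed (rule assms(3))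

lemma tm_equiv_Cons:
  assumes "symp E" "tm_equiv E xs ys"
  shows "tm_equiv E (v # xs) (v # ys)"
  using assms(2,1)
proof (induction rule: tm_equiv_induct)
  case (swap as bs a b)
  show ?case using tm_equiv_trans[OF swap(3)] tm_equiv_swap[of E a b "v # as" bs] swap(1) by simp
qed simp

lemma tm_equiv_mset:
  assumes "symp E" "tm_equiv E xs ys"
  shows "mset xs = mset ys"
  using assms(2,1) by (induction rule: tm_equiv_induct) auto

text \<open>Deleting the first \<open>v\<close> from both sides of a swap leaves either a swap or
  two equal words. Left cancellation in the trace monoid follows from this.\<close>

lemma tm_equiv_remove1:
  assumes "symp E" "tm_equiv E xs ys"
  shows "tm_equiv E (remove1 v xs) (remove1 v ys)"
  using assms(2,1)
proof (induction rule: tm_equiv_induct)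
  case (swap as bs a b)
  have "tm_equiv E (remove1 v (as @ a # b # bs)) (remove1 v (as @ b # a # bs))"
    using swap(1) by (auto simp: remove1_append intro: tm_equiv_swap)
  thus ?case by (rule tm_equiv_trans[OF swap(3)])
qed simp

text \<open>The letter \<open>v\<close> occurs in the word and commutes with everything to the left of its first
  occurrence; this is what it means for the trace of the word to be left divisible by \<open>v\<close>.\<close>

fun frontable :: "(nat \<Rightarrow> nat \<Rightarrow> bool) \<Rightarrow> nat \<Rightarrow> nat list \<Rightarrow> bool" where
  "frontable E v [] = False"
| "frontable E v (x # xs) = (x = v \<or> (E v x \<and> frontable E v xs))"

lemma frontable_tm_equiv:
  assumes "symp E" "tm_equiv E xs ys" "frontable E v xs"
  shows "frontable E v ys"
  using assms(2,1)
proof (induction rule: tm_equiv_induct)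
  case (swap as bs a b)
  have "E b a" using swap(1) assms(1) by (simp add: sympD)
  with swap(1,3) show ?case
    by (induction as) auto
qed (rule assms(3))

lemma frontable_tm_equiv_Cons_remove1:
  assumes "symp E" "frontable E v xs"
  shows "tm_equiv E xs (v # remove1 v xs)"
  using assms(2)
proof (induction xs)
  case (Cons x xs)
  show ?case
  proof (cases "x = v")
    case False
    hence "E v x" "tm_equiv E xs (v # remove1 v xs)" using Cons by auto
    hence "tm_equiv E (x # xs) (x # v # remove1 v xs)" "tm_equiv E (x # v # remove1 v xs) (v # x # remove1 v xs)"
      using tm_equiv_Cons[OF assms(1)] tm_equiv_swap[of E x v "[]"] assms(1) by (auto simp: sympD)
    hence "tm_equiv E (x # xs) (v # x # remove1 v xs)" by (rule tm_equiv_trans)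
    thus ?thesis using False by simp
  qed simp
qed simp

lemma frontable_iff_tm_equiv:
  assumes "symp E"
  shows "frontable E v xs \<longleftrightarrow> (\<exists>ys. tm_equiv E xs (v # ys))"
  using frontable_tm_equiv_Cons_remove1[OF assms, of v xs]
    frontable_tm_equiv[OF assms tm_equiv_sym, of xs _ v] by force

lemma tm_equiv_Cons_cancel:
  assumes "symp E" "tm_equiv E (v # xs) (v # ys)"
  shows "tm_equiv E xs ys"
  using tm_equiv_remove1[OF assms, of v] by simp

text \<open>The union over all representatives avoids choosing one; for symmetric \<open>E\<close>
  and a class w, all its members coincide.\<close>

definition tm_lmult :: "(nat \<Rightarrow> nat \<Rightarrow> bool) \<Rightarrow> nat \<Rightarrow> nat list set \<Rightarrow> nat list set" where
  "tm_lmult E v w = (\<Union>xs\<in>w. tm_class E (v # xs))"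

definition basis_fun :: "nat list set \<Rightarrow> nat list set \<Rightarrow> complex" where
  "basis_fun w0 w = (if w = w0 then 1 else 0)"

locale trace_graph =
  fixes L :: nat and E :: "nat \<Rightarrow> nat \<Rightarrow> bool"
  assumes graph: "simple_graph_on L E"
begin

abbreviation "TM \<equiv> trace_monoid L E"

lemma symp_E: "symp E"
  using graph by (auto simp: simple_graph_on_def symp_def)

lemma irrefl_E: "\<not> E i i"
  using graph by (auto simp: simple_graph_on_def)

lemma tm_lmult_class: "tm_lmult E v (tm_class E xs) = tm_class E (v # xs)"
proof -
  have "tm_class E (v # ys) = tm_class E (v # xs)" if "ys \<in> tm_class E xs" for ys
    using that tm_equiv_Cons[OF symp_E] by (auto simp: mem_tm_class tm_class_eq_iff intro: tm_equiv_sym)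
  moreover have "xs \<in> tm_class E xs" by (simp add: mem_tm_class)
  ultimately show ?thesis unfolding tm_lmult_def by blast
qed

lemma TM_cases:
  assumes "w \<in> TM" obtains xs where "w = tm_class E xs" "set xs \<subseteq> {1..L}"
  using assms by (auto simp: trace_monoid_def)

lemma tm_class_in_TM_iff: "tm_class E xs \<in> TM \<longleftrightarrow> set xs \<subseteq> {1..L}"
proof
  assume "tm_class E xs \<in> TM"
  then obtain ys where "tm_equiv E xs ys" "set ys \<subseteq> {1..L}"
    by (auto simp: trace_monoid_def tm_class_eq_iff)
  thus "set xs \<subseteq> {1..L}" using tm_equiv_mset[OF symp_E] by (metis set_mset_mset)
qed (auto simp: trace_monoid_def)

lemma tm_lmult_in_TM: "v \<in> {1..L} \<Longrightarrow> w \<in> TM \<Longrightarrow> tm_lmult E v w \<in> TM"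
  by (auto simp: tm_lmult_class tm_class_in_TM_iff elim!: TM_cases)

lemma tm_lmult_inj:
  assumes "w \<in> TM" "w' \<in> TM" "tm_lmult E v w = tm_lmult E v w'"
  shows "w = w'"
proof -
  obtain xs ys where w: "w = tm_class E xs" "w' = tm_class E ys"
    using assms(1,2) by (auto simp: trace_monoid_def)
  thus ?thesis using assms(3) tm_equiv_Cons_cancel[OF symp_E, of v xs ys]
    by (simp add: tm_lmult_class tm_class_eq_iff)
qed

section \<open>The letter operators and the adjacency operator\<close>

definition letter_nbr :: "nat \<Rightarrow> nat list set \<Rightarrow> nat list set set" where
  "letter_nbr v w = {w' \<in> TM. w' = tm_lmult E v w \<or> w = tm_lmult E v w'}"

lemma letter_nbr_sym: "w \<in> TM \<Longrightarrow> w' \<in> TM \<Longrightarrow> w' \<in> letter_nbr v w \<longleftrightarrow> w \<in> letter_nbr v w'"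
  by (auto simp: letter_nbr_def)

text \<open>By left cancellation at most one trace becomes w on multiplication by v.\<close>

lemma finite_letter_nbr: "finite (letter_nbr v w)"
proof -
  have "inj_on (tm_lmult E v) {w' \<in> TM. tm_lmult E v w' = w}"
    by (rule inj_onI) (simp add: tm_lmult_inj[of _ _ v])
  moreover have "finite (tm_lmult E v ` {w' \<in> TM. tm_lmult E v w' = w})"
    by (rule finite_subset[of _ "{w}"]) auto
  ultimately have "finite {w' \<in> TM. tm_lmult E v w' = w}" by (rule finite_imageD[rotated])
  moreover have "letter_nbr v w \<subseteq> insert (tm_lmult E v w) {w' \<in> TM. tm_lmult E v w' = w}"
    by (auto simp: letter_nbr_def)
  ultimately show ?thesis by (meson finite_insert finite_subset)
qed

text \<open>An edge changes the multiset of letters by exactly one letter, so it determines its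
  label. Hence summing the letter operators counts each edge of the Cayley graph once.\<close>

lemma letter_nbr_disjoint:
  assumes "w \<in> TM" "u \<noteq> v"
  shows "letter_nbr u w \<inter> letter_nbr v w = {}"
proof -
  have False if w': "w' \<in> letter_nbr u w" "w' \<in> letter_nbr v w" for w'
  proof -
    from w' have "w' \<in> TM" by (simp add: letter_nbr_def)
    then obtain xs ys where xs: "w = tm_class E xs" "w' = tm_class E ys"
      using assms(1) by (auto simp: trace_monoid_def)
    have *: "mset ys = add_mset v (mset xs) \<or> mset xs = add_mset v (mset ys)" if "w' \<in> letter_nbr v w" for v
      using that tm_equiv_mset[OF symp_E]
      by (fastforce simp: letter_nbr_def xs tm_lmult_class tm_class_eq_iff)
    from *[OF w'(1)] *[OF w'(2)] assms(2) show False
      by (auto dest: arg_cong[where f = size])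
  qed
  thus ?thesis by blast
qed

text \<open>This is \<open>A\<^sub>v\<close>, creation plus annihilation of the letter v. The value
  0 off \<open>TM\<close> keeps supports inside the monoid.\<close>

definition letter_op :: "nat \<Rightarrow> (nat list set \<Rightarrow> complex) \<Rightarrow> nat list set \<Rightarrow> complex" where
  "letter_op v f w = (if w \<in> TM then \<Sum>w'\<in>letter_nbr v w. f w' else 0)"

lemma letter_op_add: "letter_op v (\<lambda>w. f w + g w) = (\<lambda>w. letter_op v f w + letter_op v g w)"
  by (auto simp: letter_op_def sum.distrib)

lemma letter_op_scale: "letter_op v (\<lambda>w. c * f w) = (\<lambda>w. c * letter_op v f w)"
  by (auto simp: letter_op_def sum_distrib_left)

lemma cay_adjacent_iff_letter_nbr:
  assumes "w \<in> TM" "w' \<in> TM"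
  shows "cay_adjacent L E w w' \<longleftrightarrow> (\<exists>v\<in>{1..L}. w' \<in> letter_nbr v w)"
proof -
  have "(\<exists>xs\<in>w2. w1 = tm_class E (v # xs)) \<longleftrightarrow> w1 = tm_lmult E v w2" if w2: "w2 \<in> TM" for w1 w2 v
  proof -
    obtain ys where ys: "w2 = tm_class E ys" using w2 by (auto simp: trace_monoid_def)
    have "ys \<in> w2" by (simp add: ys mem_tm_class)
    moreover have "tm_class E (v # xs) = tm_lmult E v w2" if "xs \<in> w2" for xs
      using that tm_lmult_class[of v xs] by (simp add: ys mem_tm_class flip: tm_class_eq_iff)
    ultimately show ?thesis by blast
  qed
  thus ?thesis using assms by (auto simp: cay_adjacent_def letter_nbr_def)
qed

lemma cay_adj_op_eq_sum_letter_op: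
  assumes "w \<in> TM"
  shows "cay_adj_op L E f w = (\<Sum>v\<in>{1..L}. letter_op v f w)"
proof -
  have "{w' \<in> TM. cay_adjacent L E w w'} = (\<Union>v\<in>{1..L}. letter_nbr v w)"
    using cay_adjacent_iff_letter_nbr[OF assms] by (auto simp: letter_nbr_def)
  moreover have "sum f (\<Union>v\<in>{1..L}. letter_nbr v w) = (\<Sum>v\<in>{1..L}. sum f (letter_nbr v w))"
    by (rule sum.UNION_disjoint) (use letter_nbr_disjoint[OF assms] finite_letter_nbr in auto)
  ultimately show ?thesis using assms by (simp add: cay_adj_op_def letter_op_def)
qed

section \<open>Finitely supported functions and their inner product\<close>

definition fin_supp :: "(nat list set \<Rightarrow> complex) \<Rightarrow> bool" where
  "fin_supp f \<longleftrightarrow> finite {w. f w \<noteq> 0} \<and> {w. f w \<noteq> 0} \<subseteq> TM"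

lemma fin_supp_basis: "w \<in> TM \<Longrightarrow> fin_supp (basis_fun w)"
  by (auto simp: fin_supp_def basis_fun_def)

lemma fin_supp_subset: "finite F \<Longrightarrow> F \<subseteq> TM \<Longrightarrow> {w. f w \<noteq> 0} \<subseteq> F \<Longrightarrow> fin_supp f"
  unfolding fin_supp_def by (meson finite_subset subset_trans)

lemma fin_supp_add:
  assumes "fin_supp f" "fin_supp g" shows "fin_supp (\<lambda>w. f w + g w)"
  by (rule fin_supp_subset[of "{w. f w \<noteq> 0} \<union> {w. g w \<noteq> 0}"]) (use assms in \<open>auto simp: fin_supp_def\<close>)

lemma fin_supp_scale:
  assumes "fin_supp f" shows "fin_supp (\<lambda>w. c * f w)"
  by (rule fin_supp_subset[of "{w. f w \<noteq> 0}"]) (use assms in \<open>auto simp: fin_supp_def\<close>)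

lemma fin_supp_letter_op:
  assumes "fin_supp f" shows "fin_supp (letter_op v f)"
proof -
  have "{w. letter_op v f w \<noteq> 0} \<subseteq> (\<Union>w\<in>{w. f w \<noteq> 0}. letter_nbr v w)"
  proof
    fix w assume "w \<in> {w. letter_op v f w \<noteq> 0}"
    hence w: "w \<in> TM" "(\<Sum>w'\<in>letter_nbr v w. f w') \<noteq> 0" by (auto simp: letter_op_def split: if_splits)
    from w(2) obtain w' where "w' \<in> letter_nbr v w" "f w' \<noteq> 0" by (rule sum.not_neutral_contains_not_neutral)
    thus "w \<in> (\<Union>w\<in>{w. f w \<noteq> 0}. letter_nbr v w)"
      using w letter_nbr_sym[of w w' v] by (auto simp: letter_nbr_def)
  qed
  moreover have "finite (\<Union>w\<in>{w. f w \<noteq> 0}. letter_nbr v w)"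
    using assms by (auto simp: fin_supp_def finite_letter_nbr)
  ultimately have "finite {w. letter_op v f w \<noteq> 0}" by (rule finite_subset)
  thus ?thesis by (auto simp: fin_supp_def letter_op_def)
qed

text \<open>Summing over the support of \<open>g\<close> alone leaves \<open>f\<close>
  arbitrary.\<close>

definition inner_fs :: "(nat list set \<Rightarrow> complex) \<Rightarrow> (nat list set \<Rightarrow> complex) \<Rightarrow> complex" where
  "inner_fs g f = (\<Sum>w | g w \<noteq> 0. cnj (g w) * f w)"

lemma inner_fs_eq_sum:
  assumes "finite F" "{w. g w \<noteq> 0} \<subseteq> F"
  shows "inner_fs g f = (\<Sum>w\<in>F. cnj (g w) * f w)"
  unfolding inner_fs_def by (rule sum.mono_neutral_left) (use assms in auto)

lemma inner_fs_add:
  assumes "fin_supp g" "fin_supp h"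
  shows "inner_fs (\<lambda>w. g w + h w) f = inner_fs g f + inner_fs h f"
proof -
  define F where "F = {w. g w \<noteq> 0} \<union> {w. h w \<noteq> 0}"
  have "finite F" "{w. g w \<noteq> 0} \<subseteq> F" "{w. h w \<noteq> 0} \<subseteq> F" "{w. g w + h w \<noteq> 0} \<subseteq> F"
    using assms by (auto simp: F_def fin_supp_def)
  thus ?thesis by (simp add: inner_fs_eq_sum[of F] sum.distrib algebra_simps)
qed

lemma inner_fs_scale: "fin_supp g \<Longrightarrow> inner_fs (\<lambda>w. c * g w) f = cnj c * inner_fs g f"
  using inner_fs_eq_sum[of "{w. g w \<noteq> 0}" "\<lambda>w. c * g w" f] inner_fs_eq_sum[of "{w. g w \<noteq> 0}" g f]
  by (auto simp: fin_supp_def sum_distrib_left algebra_simps)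

lemma inner_fs_basis: "inner_fs (basis_fun w) f = f w"
proof -
  have "{w'. basis_fun w w' \<noteq> 0} = {w}" by (auto simp: basis_fun_def)
  thus ?thesis by (simp add: inner_fs_def) (simp add: basis_fun_def)
qed

lemma letter_op_eq_sum:
  assumes "finite F" "{w. f w \<noteq> 0} \<subseteq> F" "w \<in> TM"
  shows "letter_op v f w = (\<Sum>w'\<in>F. if w' \<in> letter_nbr v w then f w' else 0)"
proof -
  have "(\<Sum>w'\<in>F. if w' \<in> letter_nbr v w then f w' else 0) = (\<Sum>w'\<in>F \<inter> letter_nbr v w. f w')"
    using assms(1) by (simp add: sum.inter_restrict)
  also have "\<dots> = (\<Sum>w'\<in>letter_nbr v w. f w')"
    by (rule sum.mono_neutral_left) (use assms finite_letter_nbr in auto)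
  finally show ?thesis using assms(3) by (simp add: letter_op_def)
qed

text \<open>The neighbour relation is symmetric; the double sum over a common finite support can be
  exchanged.\<close>

lemma inner_fs_letter_op:
  assumes "fin_supp g" "fin_supp f"
  shows "inner_fs (letter_op v g) f = inner_fs g (letter_op v f)"
proof -
  define F where "F = {w. g w \<noteq> 0} \<union> {w. f w \<noteq> 0} \<union> {w. letter_op v g w \<noteq> 0}"
  have F: "finite F" "{w. g w \<noteq> 0} \<subseteq> F" "{w. f w \<noteq> 0} \<subseteq> F" "{w. letter_op v g w \<noteq> 0} \<subseteq> F" "F \<subseteq> TM"
    using assms fin_supp_letter_op[OF assms(1), of v] by (auto simp: F_def fin_supp_def)
  have "inner_fs (letter_op v g) f = (\<Sum>w\<in>F. \<Sum>w'\<in>F. if w' \<in> letter_nbr v w then cnj (g w') * f w else 0)"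
    unfolding inner_fs_eq_sum[OF F(1,4)]
  proof (rule sum.cong[OF refl])
    fix w assume "w \<in> F"
    hence "letter_op v g w = (\<Sum>w'\<in>F. if w' \<in> letter_nbr v w then g w' else 0)" by (intro letter_op_eq_sum) (use F in auto)
    thus "cnj (letter_op v g w) * f w = (\<Sum>w'\<in>F. if w' \<in> letter_nbr v w then cnj (g w') * f w else 0)"
      by (auto simp: sum_distrib_right intro!: sum.cong)
  qed
  also have "\<dots> = (\<Sum>w'\<in>F. \<Sum>w\<in>F. if w' \<in> letter_nbr v w then cnj (g w') * f w else 0)"
    by (rule sum.swap)
  also have "\<dots> = inner_fs g (letter_op v f)"
    unfolding inner_fs_eq_sum[OF F(1,2)]
  proof (rule sum.cong[OF refl])
    fix w' assume w': "w' \<in> F"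
    hence "letter_op v f w' = (\<Sum>w\<in>F. if w \<in> letter_nbr v w' then f w else 0)" by (intro letter_op_eq_sum) (use F in auto)
    moreover have "w \<in> letter_nbr v w' \<longleftrightarrow> w' \<in> letter_nbr v w" if "w \<in> F" for w
      using letter_nbr_sym that w' F(5) by blast
    ultimately show "(\<Sum>w\<in>F. if w' \<in> letter_nbr v w then cnj (g w') * f w else 0) = cnj (g w') * letter_op v f w'"
      by (auto simp: sum_distrib_left intro!: sum.cong)
  qed
  finally show ?thesis .
qed

text \<open>A word that is not left divisible by v has no annihilation term.\<close>

lemma letter_op_basis:
  assumes "v \<in> {1..L}" "set xs \<subseteq> {1..L}" "\<not> frontable E v xs"
  shows "letter_op v (basis_fun (tm_class E xs)) = basis_fun (tm_class E (v # xs))"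
proof
  fix w
  define w0 where "w0 = tm_class E xs"
  have w0: "w0 \<in> TM" using assms by (simp add: w0_def tm_class_in_TM_iff)
  have "w \<in> TM \<Longrightarrow> w0 \<noteq> tm_lmult E v w"
    using assms(3) by (auto simp: w0_def tm_lmult_class tm_class_eq_iff frontable_iff_tm_equiv[OF symp_E] elim!: TM_cases)
  moreover have "tm_lmult E v w0 \<in> TM" using tm_lmult_in_TM assms(1) w0 by blast
  ultimately have "w \<in> TM \<and> w0 \<in> letter_nbr v w \<longleftrightarrow> w = tm_lmult E v w0"
    using w0 by (auto simp: letter_nbr_def)
  moreover have "letter_op v (basis_fun w0) w = (if w \<in> TM \<and> w0 \<in> letter_nbr v w then 1 else 0)"
    using finite_letter_nbr by (simp add: letter_op_def basis_fun_def)
  ultimately show "letter_op v (basis_fun (tm_class E xs)) w = basis_fun (tm_class E (v # xs)) w"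
    by (simp add: w0_def basis_fun_def tm_lmult_class)
qed

text \<open>Creation adds a second v and annihilation removes the first; by length the two results
  differ, so the values do not overlap.\<close>

lemma letter_op_basis_Cons:
  assumes "v \<in> {1..L}" "set xs \<subseteq> {1..L}"
  shows "letter_op v (basis_fun (tm_class E (v # xs)))
    = (\<lambda>w. basis_fun (tm_class E (v # v # xs)) w + basis_fun (tm_class E xs) w)"
proof
  fix w
  define w1 where "w1 = tm_class E xs"
  define w0 where "w0 = tm_class E (v # xs)"
  have w0: "w0 \<in> TM" "w1 \<in> TM" "w0 = tm_lmult E v w1"
    using assms by (simp_all add: w0_def w1_def tm_class_in_TM_iff tm_lmult_class)
  have in_TM: "tm_lmult E v w0 \<in> TM" using tm_lmult_in_TM assms(1) w0 by blast
  have neq: "tm_lmult E v w0 \<noteq> w1"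
  proof
    assume "tm_lmult E v w0 = w1"
    hence "tm_equiv E (v # v # xs) xs" by (simp add: w0_def w1_def tm_lmult_class tm_class_eq_iff)
    hence "mset (v # v # xs) = mset xs" by (rule tm_equiv_mset[OF symp_E])
    thus False by (auto dest: arg_cong[where f = size])
  qed
  have "w \<in> TM \<and> w0 \<in> letter_nbr v w \<longleftrightarrow> w = tm_lmult E v w0 \<or> w = w1"
    using w0 in_TM tm_lmult_inj[of w w1 v] by (auto simp: letter_nbr_def)
  moreover have "letter_op v (basis_fun w0) w = (if w \<in> TM \<and> w0 \<in> letter_nbr v w then 1 else 0)"
    using finite_letter_nbr by (simp add: letter_op_def basis_fun_def)
  ultimately have "letter_op v (basis_fun w0) w = basis_fun (tm_lmult E v w0) w + basis_fun w1 w"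
    using neq by (auto simp: basis_fun_def)
  thus "letter_op v (basis_fun (tm_class E (v # xs))) w
     = basis_fun (tm_class E (v # v # xs)) w + basis_fun (tm_class E xs) w"
    by (simp add: w0_def w1_def tm_lmult_class)
qed

end

section \<open>Graph independent semicircle variables\<close>

text \<open>The Chebyshev polynomials \<open>U\<^sub>n(x/2)\<close>, orthonormal for the semicircle law.\<close>

fun semicircle_poly :: "nat \<Rightarrow> real poly" where
  "semicircle_poly 0 = 1"
| "semicircle_poly (Suc 0) = [:0, 1:]"
| "semicircle_poly (Suc (Suc n)) = [:0, 1:] * semicircle_poly (Suc n) - semicircle_poly n"

lemma poly_semicircle_poly_cos: "poly (semicircle_poly n) (2 * cos t) * sin t = sin (real (Suc n) * t)"
proof (induction n rule: semicircle_poly.induct)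
  case 2
  show ?case using sin_double[of t] by (simp add: mult_ac)
next
  case (3 n)
  have "sin (real (Suc (Suc (Suc n))) * t) + sin (real (Suc n) * t)
      = 2 * cos t * sin (real (Suc (Suc n)) * t)"
  proof -
    have "real (Suc (Suc (Suc n))) * t = real (Suc (Suc n)) * t + t"
      "real (Suc n) * t = real (Suc (Suc n)) * t - t"
      by (simp_all add: algebra_simps)
    thus ?thesis by (simp only: sin_add sin_diff) simp
  qed
  moreover have "poly (semicircle_poly (Suc (Suc n))) (2 * cos t) * sin t
      = 2 * cos t * (poly (semicircle_poly (Suc n)) (2 * cos t) * sin t) - poly (semicircle_poly n) (2 * cos t) * sin t"
    by (simp add: algebra_simps)
  ultimately show ?case using 3 by simp
qed simp

text \<open>An antiderivative is found through x = 2 cos t: G' is -4 sin((n+1)t) sin t, and the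
  factor -1/(2 sin t) of the substitution leaves 2 sin((n+1)t), the integrand. G vanishes at t = 0
  and t = pi; n \<ge> 1 permits the division by n.\<close>

lemma semicircle_poly_has_integral_zero:
  assumes "n \<ge> 1"
  shows "((\<lambda>x. poly (semicircle_poly n) x * sqrt (4 - x\<^sup>2)) has_integral 0) {-2..2}"
proof -
  define G where "G t = 2 * sin (real (n + 2) * t) / real (n + 2) - 2 * sin (real n * t) / real n" for t :: real
  define F where "F x = G (arccos (x / 2))" for x
  have G': "(G has_real_derivative (2 * cos (real (n + 2) * t) - 2 * cos (real n * t))) (at t)" for t
    unfolding G_def using assms by (auto intro!: derivative_eq_intros)
  have G'': "2 * cos (real (n + 2) * t) - 2 * cos (real n * t) = - 4 * (sin (real (Suc n) * t) * sin t)" for t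
  proof -
    have "real (n + 2) * t = real (Suc n) * t + t" "real n * t = real (Suc n) * t - t"
      by (simp_all add: algebra_simps)
    thus ?thesis by (simp only: cos_add cos_diff) simp
  qed
  have "((\<lambda>x. poly (semicircle_poly n) x * sqrt (4 - x\<^sup>2)) has_integral (F 2 - F (-2))) {-2..2}"
  proof (rule fundamental_theorem_of_calculus_interior)
    have "continuous_on {-2..2} (\<lambda>x::real. arccos (x / 2))"
      by (intro continuous_on_arccos continuous_intros) auto
    thus "continuous_on {-2..2} F" unfolding F_def G_def using assms
      by (intro continuous_intros) auto
    fix x :: real assume "x \<in> {-2<..<2}"
    hence x: "-1 < x / 2" "x / 2 < 1" by auto
    define t where "t = arccos (x / 2)"
    have ct: "cos t = x / 2" unfolding t_def using x by (intro cos_arccos) auto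
    have st: "sin t = sqrt (1 - (x / 2)\<^sup>2)" unfolding t_def using x by (intro sin_arccos) auto
    have "\<bar>x / 2\<bar> < 1" using x by auto
    hence "(x / 2)\<^sup>2 < 1" by (simp only: abs_square_less_1)
    hence st0: "sin t > 0" unfolding st by simp
    have "sqrt (4 - x\<^sup>2) = sqrt (4 * (1 - (x / 2)\<^sup>2))" by (simp add: power_divide)
    also have "\<dots> = 2 * sin t" unfolding st real_sqrt_mult by simp
    finally have sq: "sqrt (4 - x\<^sup>2) = 2 * sin t" .
    have "((\<lambda>x. arccos (x / 2)) has_real_derivative (inverse (- sqrt (1 - (x / 2)\<^sup>2)) * (1 / 2))) (at x)"
      by (rule DERIV_chain2[of arccos _ "\<lambda>x. x / 2"]) (use x in \<open>auto intro!: DERIV_arccos derivative_eq_intros\<close>)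
    hence A': "((\<lambda>x. arccos (x / 2)) has_real_derivative (inverse (- sin t) * (1 / 2))) (at x)"
      unfolding st .
    have "(G has_real_derivative (- 4 * (sin (real (Suc n) * t) * sin t))) (at (arccos (x / 2)))"
      using G'[of t] unfolding G'' t_def .
    from DERIV_chain2[OF this A']
    have "(F has_real_derivative ((- 4 * (sin (real (Suc n) * t) * sin t)) * (inverse (- sin t) * (1 / 2)))) (at x)"
      unfolding F_def .
    also have "(- 4 * (sin (real (Suc n) * t) * sin t)) * (inverse (- sin t) * (1 / 2)) = 2 * sin (real (Suc n) * t)"
      using st0 by (simp add: field_simps)
    also have "\<dots> = poly (semicircle_poly n) x * sqrt (4 - x\<^sup>2)"
      using poly_semicircle_poly_cos[of n t] by (simp add: sq ct)
    finally show "(F has_vector_derivative poly (semicircle_poly n) x * sqrt (4 - x\<^sup>2)) (at x)"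
      by (simp add: has_real_derivative_iff_has_vector_derivative)
  qed simp
  moreover have "F 2 = 0" by (simp add: F_def G_def)
  moreover have "F (-2) = 0"
  proof -
    have "sin (real (n + 2) * pi) = 0" "sin (real n * pi) = 0" by (rule sin_npi)+
    hence "G pi = 0" unfolding G_def by (simp only:)
    thus ?thesis by (simp add: F_def)
  qed
  ultimately show ?thesis by simp
qed

lemma alg_poly_in_gen_star_alg: "alg_poly x p \<in> gen_star_alg x"
proof (induction p)
  case 0
  show ?case using gen_scaleC[OF gen_one, of 0 x] by simp
next
  case (pCons c p)
  have "scaleC (of_real c) 1 + x * alg_poly x p \<in> gen_star_alg x"
    by (intro gen_star_alg.intros pCons)
  thus ?case by (simp add: alg_poly_pCons scaleC_of_real)
qed

context cstar_state
begin

lemma tau_alg_poly_semicircle: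
  assumes "semicircle_var \<tau> x"
  shows "\<tau> (alg_poly x p) = of_real (integral {-2..2} (\<lambda>t. poly p t * sqrt (4 - t\<^sup>2) / (2 * pi)))"
proof -
  have "\<tau> (alg_poly x p) = (\<Sum>i\<le>degree p. of_real (coeff p i) * \<tau> (x ^ i))"
    by (simp add: alg_poly_def tau_sum tau_scaleR)
  also have "\<dots> = of_real (\<Sum>i\<le>degree p. coeff p i * integral {-2..2} (\<lambda>t::real. t ^ i * sqrt (4 - t\<^sup>2) / (2 * pi)))"
    using assms by (simp add: semicircle_var_def)
  also have "(\<Sum>i\<le>degree p. coeff p i * integral {-2..2} (\<lambda>t::real. t ^ i * sqrt (4 - t\<^sup>2) / (2 * pi)))
     = (\<Sum>i\<le>degree p. integral {-2..2} (\<lambda>t::real. coeff p i * (t ^ i * sqrt (4 - t\<^sup>2) / (2 * pi))))"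
    by (simp only: integral_mult_right)
  also have "\<dots> = integral {-2..2} (\<lambda>t. \<Sum>i\<le>degree p. coeff p i * (t ^ i * sqrt (4 - t\<^sup>2) / (2 * pi)))"
    by (rule integral_sum[symmetric])
       (auto intro!: integrable_continuous_interval continuous_intros)
  also have "\<dots> = integral {-2..2} (\<lambda>t. poly p t * sqrt (4 - t\<^sup>2) / (2 * pi))"
    by (rule integral_cong) (simp add: poly_altdef sum_distrib_right sum_divide_distrib mult.assoc)
  finally show ?thesis .
qed

lemma tau_semicircle_poly_semicircle:
  assumes "semicircle_var \<tau> x" "n \<ge> 1"
  shows "\<tau> (alg_poly x (semicircle_poly n)) = 0"
  using integral_unique[OF has_integral_divide[OF semicircle_poly_has_integral_zero[OF assms(2)], of "2 * pi"]]
  unfolding tau_alg_poly_semicircle[OF assms(1)] by simp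

end

section \<open>Reduced words and words of blocks\<close>

fun reduced_word :: "(nat \<Rightarrow> nat \<Rightarrow> bool) \<Rightarrow> nat list \<Rightarrow> bool" where
  "reduced_word E [] = True"
| "reduced_word E (i # is) = (reduced_word E is \<and> \<not> frontable E i is)"

lemma frontable_nth:
  "k < length is \<Longrightarrow> is ! k = i \<Longrightarrow> (\<And>m. m < k \<Longrightarrow> E i (is ! m)) \<Longrightarrow> frontable E i is"
proof (induction "is" arbitrary: k)
  case (Cons x xs)
  show ?case
  proof (cases k)
    case (Suc m)
    have "frontable E i xs"
    proof (rule Cons.IH[of m])
      show "E i (xs ! j)" if "j < m" for j using Cons.prems(3)[of "Suc j"] that Suc by simp
    qed (use Cons.prems Suc in auto)
    thus ?thesis using Cons.prems(3)[of 0] Suc by simp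
  qed (use Cons in auto)
qed simp

text \<open>If all letters between two equal ones commuted with them, the left one would be
  frontable in the word after it. This yields the index condition of graph independence.\<close>

lemma reduced_word_separated:
  "reduced_word E is \<Longrightarrow> j1 < j2 \<Longrightarrow> j2 < length is \<Longrightarrow> is ! j1 = is ! j2 \<Longrightarrow>
   \<exists>j3. j1 < j3 \<and> j3 < j2 \<and> \<not> E (is ! j1) (is ! j3)"
proof (induction "is" arbitrary: j1 j2)
  case (Cons x xs)
  obtain k where k: "j2 = Suc k" "k < length xs" using Cons.prems by (cases j2) auto
  show ?case
  proof (cases j1)
    case 0
    hence "xs ! k = x" using Cons.prems k by simp
    then obtain m where "m < k" "\<not> E x (xs ! m)"
      using frontable_nth[OF k(2), of x E] Cons.prems(1) by auto
    thus ?thesis using 0 k by (intro exI[of _ "Suc m"]) simp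
  next
    case (Suc i)
    then obtain j3 where "i < j3" "j3 < k" "\<not> E (xs ! i) (xs ! j3)"
      using Cons.IH[of i k] Cons.prems k by auto
    thus ?thesis using Suc k by (intro exI[of _ "Suc j3"]) simp
  qed
qed simp

lemma frontable_remove_middle:
  assumes "frontable E i (ps @ xs)" "E i v"
  shows "frontable E i (ps @ v # xs)"
  using assms by (induction ps) auto

text \<open>An earlier letter that becomes frontable once v is gone was frontable before, since it
  commutes with v. This covers a block whose exponent drops to 0.\<close>

lemma reduced_word_remove_middle:
  assumes "symp E" "reduced_word E (ps @ v # xs)" "\<forall>x\<in>set ps. E v x"
  shows "reduced_word E (ps @ xs)"
  using assms(2,3)
proof (induction ps)
  case (Cons p ps)
  thus ?case using frontable_remove_middle[of E p ps xs v] sympD[OF assms(1), of v p] by auto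
qed simp

lemma frontable_split:
  assumes "frontable E v (map fst B)"
  obtains P n R where "B = P @ (v, n) # R" "\<forall>x\<in>fst ` set P. E v x"
  using assms
proof (induction B arbitrary: thesis)
  case (Cons b B)
  show ?case
  proof (cases "fst b = v")
    case True
    hence "b = (v, snd b)" by (cases b) simp
    thus ?thesis using Cons.prems(1)[of "[]" "snd b" B] by simp
  next
    case False
    hence *: "E v (fst b)" "frontable E v (map fst B)" using Cons.prems by auto
    then obtain P n R where "B = P @ (v, n) # R" "\<forall>x\<in>fst ` set P. E v x" using Cons.IH by blast
    thus ?thesis using Cons.prems(1)[of "b # P" n R] * by auto
  qed
qed simp

definition block_word :: "(nat \<times> nat) list \<Rightarrow> nat list" where
  "block_word B = concat (map (\<lambda>(j, n). replicate n j) B)"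

lemma block_word_simps [simp]:
  "block_word [] = []"
  "block_word ((j, n) # B) = replicate n j @ block_word B"
  "block_word (P @ R) = block_word P @ block_word R"
  by (simp_all add: block_word_def)

lemma set_block_word: "set (block_word B) \<subseteq> fst ` set B"
  by (induction B) auto

lemma frontable_block_word:
  assumes "\<forall>b\<in>set B. snd b \<ge> 1" "\<not> E v v"
  shows "frontable E v (block_word B) \<longleftrightarrow> frontable E v (map fst B)"
  using assms(1)
proof (induction B)
  case (Cons b B)
  obtain j m where b: "b = (j, Suc m)" using Cons.prems by (cases b; cases "snd b") auto
  have "frontable E v (replicate (Suc m) j @ xs) \<longleftrightarrow> (j = v \<or> (E v j \<and> frontable E v xs))" for xs
    by (induction m) auto
  thus ?case using Cons b by simp
qed simp

lemma tm_equiv_move: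
  assumes "symp E" "\<forall>x\<in>set ps. E v x"
  shows "tm_equiv E (ps @ v # xs) (v # ps @ xs)"
  using assms(2)
proof (induction ps)
  case (Cons p ps)
  have "tm_equiv E (p # ps @ v # xs) (p # v # ps @ xs)"
    using Cons tm_equiv_Cons[OF assms(1)] by simp
  moreover have "tm_equiv E (p # v # ps @ xs) (v # p # ps @ xs)"
    using tm_equiv_swap[of E p v "[]"] Cons.prems sympD[OF assms(1)] by simp
  ultimately show ?case using tm_equiv_trans by fastforce
qed simp

section \<open>Chebyshev products and the isometry onto finitely supported functions\<close>

locale graph_semicirculars = trace_graph L E + cstar_state \<tau>
  for L E and \<tau> :: "'a::cstar_algebra \<Rightarrow> complex" +
  fixes s :: "nat \<Rightarrow> 'a"
  assumes semicircle: "\<forall>i\<in>{1..L}. semicircle_var \<tau> (s i)"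
    and indep: "G_independent_vars L E \<tau> s"
begin

lemma s_selfadjoint: "i \<in> {1..L} \<Longrightarrow> adj (s i) = s i"
  using semicircle by (auto simp: semicircle_var_def)

lemma s_commute: "E i j \<Longrightarrow> s i * alg_poly (s j) p = alg_poly (s j) p * s i"
  using indep gen_elem[of "s i"] alg_poly_in_gen_star_alg[of "s j" p]
  unfolding G_independent_vars_def G_independent_def by blast

text \<open>A block j^n becomes U_n(s_j / 2), so this is the counterpart in the algebra of the basis
  vector at \<open>block_word B\<close>.\<close>

definition block_elt :: "(nat \<times> nat) list \<Rightarrow> 'a" where
  "block_elt B = prod_list (map (\<lambda>(j, n). alg_poly (s j) (semicircle_poly n)) B)"

lemma block_elt_simps [simp]:
  "block_elt [] = 1"
  "block_elt ((j, n) # B) = alg_poly (s j) (semicircle_poly n) * block_elt B"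
  "block_elt (P @ R) = block_elt P * block_elt R"
  by (simp_all add: block_elt_def)

definition reduced_blocks :: "(nat \<times> nat) list \<Rightarrow> bool" where
  "reduced_blocks B \<longleftrightarrow> reduced_word E (map fst B) \<and> (\<forall>b\<in>set B. fst b \<in> {1..L} \<and> snd b \<ge> 1)"

text \<open>The index word is reduced and every factor is centred because its exponent is positive,
  so graph independence applies.\<close>

lemma tau_block_elt:
  assumes "reduced_blocks B" "B \<noteq> []"
  shows "\<tau> (block_elt B) = 0"
proof -
  have *: "\<And>(idx::nat list) (as::'a list).
        length idx \<ge> 1 \<Longrightarrow> length as = length idx \<Longrightarrow> set idx \<subseteq> {1..L} \<Longrightarrow>
        (\<forall>j1 j2. j1 < j2 \<and> j2 < length idx \<and> idx ! j1 = idx ! j2 \<longrightarrow>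
           (\<exists>j3. j1 < j3 \<and> j3 < j2 \<and> \<not> E (idx ! j1) (idx ! j3))) \<Longrightarrow>
        (\<forall>j < length idx. as ! j \<in> gen_star_alg (s (idx ! j)) \<and> \<tau> (as ! j) = 0) \<Longrightarrow>
        \<tau> (prod_list as) = 0"
    using indep unfolding G_independent_vars_def G_independent_def by blast
  show ?thesis unfolding block_elt_def
  proof (rule *[of "map fst B"])
    show "length (map fst B) \<ge> 1" using assms(2) by (cases B) auto
    show "set (map fst B) \<subseteq> {1..L}" using assms(1) by (auto simp: reduced_blocks_def)
    show "\<forall>j1 j2. j1 < j2 \<and> j2 < length (map fst B) \<and> map fst B ! j1 = map fst B ! j2 \<longrightarrow>
           (\<exists>j3. j1 < j3 \<and> j3 < j2 \<and> \<not> E (map fst B ! j1) (map fst B ! j3))"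
      using reduced_word_separated[of E "map fst B"] assms(1) unfolding reduced_blocks_def by blast
    show "\<forall>j<length (map fst B). map (\<lambda>(j, n). alg_poly (s j) (semicircle_poly n)) B ! j \<in> gen_star_alg (s (map fst B ! j)) \<and>
        \<tau> (map (\<lambda>(j, n). alg_poly (s j) (semicircle_poly n)) B ! j) = 0"
    proof (intro allI impI)
      fix j assume j: "j < length (map fst B)"
      obtain i n where i: "B ! j = (i, n)" by (cases "B ! j")
      have "(i, n) \<in> set B" using j i by (metis length_map nth_mem)
      hence "i \<in> {1..L}" "n \<ge> 1" using assms(1) by (auto simp: reduced_blocks_def)
      thus "map (\<lambda>(j, n). alg_poly (s j) (semicircle_poly n)) B ! j \<in> gen_star_alg (s (map fst B ! j)) \<and>
        \<tau> (map (\<lambda>(j, n). alg_poly (s j) (semicircle_poly n)) B ! j) = 0"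
        using j i semicircle by (simp add: alg_poly_in_gen_star_alg tau_semicircle_poly_semicircle)
    qed
  qed simp
qed

text \<open>As a relation, the correspondence needs no uniqueness of expansions in block
  elements.\<close>

inductive block_span :: "'a \<Rightarrow> (nat list set \<Rightarrow> complex) \<Rightarrow> bool" where
  block: "reduced_blocks B \<Longrightarrow> block_span (block_elt B) (basis_fun (tm_class E (block_word B)))"
| add: "block_span x f \<Longrightarrow> block_span y g \<Longrightarrow> block_span (x + y) (\<lambda>w. f w + g w)"
| scale: "block_span x f \<Longrightarrow> block_span (scaleC c x) (\<lambda>w. c * f w)"

lemma tau_block_span: "block_span x f \<Longrightarrow> \<tau> x = f (tm_class E [])"
proof (induction rule: block_span.induct)
  case (block B)
  show ?case
  proof (cases B)
    case Nil
    thus ?thesis by (simp add: tau_one basis_fun_def)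
  next
    case (Cons b B')
    hence "block_word B \<noteq> []" using block by (cases b) (auto simp: reduced_blocks_def)
    hence "tm_class E [] \<noteq> tm_class E (block_word B)"
      using tm_equiv_mset[OF symp_E, of "[]" "block_word B"] by (auto simp: tm_class_eq_iff)
    thus ?thesis using tau_block_elt[OF block] Cons by (simp add: basis_fun_def)
  qed
qed (simp_all add: tau_add tau_scaleC)

text \<open>If v cannot be merged with a block, it starts a new one and only creation occurs.
  Otherwise it passes the commuting blocks of P, and x U_n = U_(n+1) + U_(n-1) (in the variable x/2)
  matches creation plus annihilation.\<close>

lemma block_span_mult_block:
  assumes B: "reduced_blocks B" and v: "v \<in> {1..L}"
  shows "block_span (s v * block_elt B) (letter_op v (basis_fun (tm_class E (block_word B))))"
proof (cases "frontable E v (map fst B)")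
  case False
  have "\<not> frontable E v (block_word B)"
    using False B frontable_block_word irrefl_E by (auto simp: reduced_blocks_def)
  moreover have "set (block_word B) \<subseteq> {1..L}"
    by (rule order_trans[OF set_block_word]) (use B in \<open>auto simp: reduced_blocks_def\<close>)
  ultimately have "letter_op v (basis_fun (tm_class E (block_word B))) = basis_fun (tm_class E (block_word ((v, 1) # B)))"
    using letter_op_basis[OF v] by simp
  moreover have "s v * block_elt B = block_elt ((v, 1) # B)"
    by (simp add: alg_poly_pCons)
  moreover have "reduced_blocks ((v, 1) # B)"
    using B v False by (simp add: reduced_blocks_def)
  ultimately show ?thesis using block by metis
next
  case True
  then obtain P n R where PR: "B = P @ (v, n) # R" "\<forall>x\<in>fst ` set P. E v x"
    by (rule frontable_split)
  obtain m where n: "n = Suc m" using B by (cases n) (auto simp: PR reduced_blocks_def)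
  have P: "s v * block_elt P = block_elt P * s v"
    using PR(2)
  proof (induction P)
    case (Cons b P)
    obtain j k where b: "b = (j, k)" by (cases b)
    hence "s v * alg_poly (s j) (semicircle_poly k) = alg_poly (s j) (semicircle_poly k) * s v"
      using Cons.prems by (intro s_commute) auto
    thus ?case using Cons b by simp (metis mult.assoc)
  qed simp
  define B1 where "B1 = P @ (v, Suc n) # R"
  \<comment> \<open>Blocks must have positive exponent, so for m = 0 the block is dropped; its
    factor would be U_0 = 1.\<close>
  define B0 where "B0 = (if m = 0 then P @ R else P @ (v, m) # R)"
  have red: "reduced_word E (map fst P @ v # map fst R)" using B by (simp add: reduced_blocks_def PR)
  have "reduced_word E (map fst P @ map fst R)"
    by (rule reduced_word_remove_middle[OF symp_E red]) (use PR(2) in auto)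
  hence rb: "reduced_blocks B1" "reduced_blocks B0"
    using B v by (auto simp: B1_def B0_def reduced_blocks_def PR)
  hence "block_span (block_elt B1 + block_elt B0)
      (\<lambda>w. basis_fun (tm_class E (block_word B1)) w + basis_fun (tm_class E (block_word B0)) w)"
    by (intro block_span.intros)
  moreover have "s v * block_elt B = block_elt B1 + block_elt B0"
  proof -
    have "alg_poly (s v) (semicircle_poly (Suc n)) = s v * alg_poly (s v) (semicircle_poly n) - alg_poly (s v) (semicircle_poly m)"
      by (simp add: n alg_poly_diff alg_poly_pCons)
    hence "s v * alg_poly (s v) (semicircle_poly n) = alg_poly (s v) (semicircle_poly (Suc n)) + alg_poly (s v) (semicircle_poly m)"
      by simp
    moreover have "s v * block_elt B = block_elt P * (s v * alg_poly (s v) (semicircle_poly n)) * block_elt R"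
      by (simp add: PR(1) mult.assoc[symmetric] P)
    moreover have "block_elt B0 = block_elt P * alg_poly (s v) (semicircle_poly m) * block_elt R"
      by (simp add: B0_def mult.assoc)
    ultimately show ?thesis
      by (simp add: B1_def distrib_left distrib_right mult.assoc del: semicircle_poly.simps)
  qed
  moreover have "letter_op v (basis_fun (tm_class E (block_word B)))
     = (\<lambda>w. basis_fun (tm_class E (block_word B1)) w + basis_fun (tm_class E (block_word B0)) w)"
  proof -
    have w0: "block_word B0 = block_word P @ replicate m v @ block_word R"
      by (simp add: B0_def)
    have "\<forall>x\<in>set (block_word P). E v x" using PR(2) set_block_word[of P] by auto
    note mv = tm_equiv_move[OF symp_E this]
    have 1: "tm_class E (block_word B) = tm_class E (v # block_word B0)"
      using mv[of "replicate m v @ block_word R"] by (simp add: PR n w0 tm_class_eq_iff)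
    have "tm_class E (block_word B1) = tm_class E (v # block_word B)"
      using mv[of "replicate n v @ block_word R"] by (simp add: PR B1_def tm_class_eq_iff)
    also have "\<dots> = tm_class E (v # v # block_word B0)"
      using 1 tm_lmult_class by metis
    finally have 2: "tm_class E (block_word B1) = tm_class E (v # v # block_word B0)" .
    have "set (block_word B0) \<subseteq> {1..L}"
      by (rule order_trans[OF set_block_word]) (use rb(2) in \<open>auto simp: reduced_blocks_def\<close>)
    thus ?thesis unfolding 1 2 by (rule letter_op_basis_Cons[OF v])
  qed
  ultimately show ?thesis by simp
qed

lemma block_span_mult: "block_span x f \<Longrightarrow> v \<in> {1..L} \<Longrightarrow> block_span (s v * x) (letter_op v f)"
proof (induction rule: block_span.induct)
  case (block B)
  thus ?case by (rule block_span_mult_block)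
next
  case (add x f y g)
  thus ?case by (simp add: distrib_left letter_op_add block_span.add)
next
  case (scale x f c)
  thus ?case by (simp add: mult_scaleC_right letter_op_scale block_span.scale)
qed

text \<open>Pairs \<open>p(s)\<close>, \<open>p(A)\<delta>\<^sub>e\<close> for noncommutative polynomials \<open>p\<close>, where \<open>A\<^sub>v\<close> is the operator \<open>letter_op v\<close>.\<close>

inductive fock :: "'a \<Rightarrow> (nat list set \<Rightarrow> complex) \<Rightarrow> bool" where
  one: "fock 1 (basis_fun (tm_class E []))"
| mult: "fock x f \<Longrightarrow> v \<in> {1..L} \<Longrightarrow> fock (s v * x) (letter_op v f)"
| add: "fock x f \<Longrightarrow> fock y g \<Longrightarrow> fock (x + y) (\<lambda>w. f w + g w)"
| scale: "fock x f \<Longrightarrow> fock (scaleC c x) (\<lambda>w. c * f w)"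

lemma fock_block_span: "fock x f \<Longrightarrow> block_span x f"
proof (induction rule: fock.induct)
  case one
  show ?case using block[of "[]"] by (simp add: reduced_blocks_def)
qed (auto intro: block_span.intros block_span_mult)

lemma fock_fin_supp: "fock x f \<Longrightarrow> fin_supp f"
  by (induction rule: fock.induct)
     (auto intro: fin_supp_add fin_supp_scale fin_supp_letter_op fin_supp_basis simp: tm_class_in_TM_iff)

text \<open>Each self-adjoint s_v moves from y to x, in step with the symmetric operator
  \<open>letter_op v\<close>, until y = 1; there the trace reads off the coefficient at the empty
  word.\<close>

lemma tau_fock: "fock y g \<Longrightarrow> fock x f \<Longrightarrow> \<tau> (adj y * x) = inner_fs g f"
proof (induction arbitrary: x f rule: fock.induct)
  case one
  thus ?case using tau_block_span[OF fock_block_span] by (simp add: inner_fs_basis)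
next
  case (mult y g v)
  have "\<tau> (adj (s v * y) * x) = \<tau> (adj y * (s v * x))"
    using mult by (simp add: adj_mult s_selfadjoint mult.assoc)
  also have "\<dots> = inner_fs g (letter_op v f)" using mult by (intro mult.IH fock.mult)
  also have "\<dots> = inner_fs (letter_op v g) f" using mult fock_fin_supp by (simp add: inner_fs_letter_op)
  finally show ?case .
next
  case (add y g z h)
  thus ?case using fock_fin_supp by (simp add: adj_add distrib_right tau_add inner_fs_add)
next
  case (scale y g c)
  thus ?case using fock_fin_supp by (simp add: adj_scaleC mult_scaleC_left tau_scaleC inner_fs_scale)
qed

text \<open>Applying \<open>letter_op v\<close> to the basis vector of the tail gives the wanted
  vector, plus that of a shorter word if the tail is divisible by v; strong induction on length
  allows subtracting it.\<close>

lemma fock_basis: "set xs \<subseteq> {1..L} \<Longrightarrow> \<exists>x. fock x (basis_fun (tm_class E xs))"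
proof (induction xs rule: length_induct)
  case (1 xs)
  show ?case
  proof (cases xs)
    case Nil
    thus ?thesis using fock.one by blast
  next
    case (Cons v ys)
    have v: "v \<in> {1..L}" and ys: "set ys \<subseteq> {1..L}" using 1(2) Cons by auto
    obtain y where y: "fock y (basis_fun (tm_class E ys))" using 1(1) ys Cons by auto
    show ?thesis
    proof (cases "frontable E v ys")
      case False
      thus ?thesis using fock.mult[OF y v] letter_op_basis[OF v ys] Cons by auto
    next
      case True
      define zs where "zs = remove1 v ys"
      have eq: "tm_class E ys = tm_class E (v # zs)"
        using frontable_tm_equiv_Cons_remove1[OF symp_E True] by (simp add: zs_def tm_class_eq_iff)
      have zs: "set zs \<subseteq> {1..L}" "length zs < length xs"
        using ys set_remove1_subset[of v ys] length_remove1[of v ys] Cons by (auto simp: zs_def)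
      then obtain z where z: "fock z (basis_fun (tm_class E zs))" using 1(1) by auto
      have "tm_class E xs = tm_class E (v # v # zs)" using eq Cons tm_lmult_class by metis
      hence "letter_op v (basis_fun (tm_class E ys)) = (\<lambda>w. basis_fun (tm_class E xs) w + basis_fun (tm_class E zs) w)"
        using letter_op_basis_Cons[OF v zs(1)] eq by simp
      hence "basis_fun (tm_class E xs) = (\<lambda>w. letter_op v (basis_fun (tm_class E ys)) w + (-1) * basis_fun (tm_class E zs) w)"
        by simp
      moreover have "fock (s v * y + scaleC (-1) z) (\<lambda>w. letter_op v (basis_fun (tm_class E ys)) w + (-1) * basis_fun (tm_class E zs) w)"
        by (intro fock.add fock.scale fock.mult y z v)
      ultimately show ?thesis by metis
    qed
  qed
qed

lemma fock_surj:
  assumes "fin_supp f" shows "\<exists>x. fock x f"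
proof -
  have "\<exists>x. fock x f" if "finite F" "F \<subseteq> TM" "{w. f w \<noteq> 0} \<subseteq> F" for F f
    using that
  proof (induction F arbitrary: f rule: finite_induct)
    case empty
    hence "f = (\<lambda>w. 0 * basis_fun (tm_class E []) w)" by auto
    thus ?case using fock.scale[OF fock.one, of 0] by metis
  next
    case (insert w0 F)
    define g where "g w = (if w = w0 then 0 else f w)" for w
    have "{w. g w \<noteq> 0} \<subseteq> F" using insert.prems by (auto simp: g_def)
    then obtain y where y: "fock y g" using insert.IH[of g] insert.prems(1) by auto
    obtain xs where "w0 = tm_class E xs" "set xs \<subseteq> {1..L}"
      using insert.prems(1) by (auto elim: TM_cases)
    then obtain x where x: "fock x (basis_fun w0)" using fock_basis by blast
    have "f = (\<lambda>w. g w + f w0 * basis_fun w0 w)" by (auto simp: g_def basis_fun_def)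
    thus ?case using fock.add[OF y fock.scale[OF x, of "f w0"]] by metis
  qed
  thus ?thesis using assms by (auto simp: fin_supp_def)
qed

section \<open>Comparison of the two norms\<close>

definition S :: 'a where "S = (\<Sum>i=1..L. s i)"

text \<open>Agrees with \<open>cay_adj_op\<close> on \<open>TM\<close> and vanishes elsewhere, so
  finite supports stay inside \<open>TM\<close>.\<close>

definition cay_op :: "(nat list set \<Rightarrow> complex) \<Rightarrow> nat list set \<Rightarrow> complex" where
  "cay_op f w = (\<Sum>v=1..L. letter_op v f w)"

lemma cay_op_eq: "w \<in> TM \<Longrightarrow> cay_op f w = cay_adj_op L E f w"
  by (simp add: cay_op_def cay_adj_op_eq_sum_letter_op)

lemma fock_S: assumes "fock x f" shows "fock (S * x) (cay_op f)"
proof -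
  have "fock ((\<Sum>i\<in>I. s i) * x) (\<lambda>w. \<Sum>v\<in>I. letter_op v f w)" if "finite I" "I \<subseteq> {1..L}" for I
    using that
  proof (induction I rule: finite_induct)
    case empty
    show ?case using fock.scale[OF assms, of 0] by simp
  next
    case (insert i I)
    thus ?case using fock.add[OF fock.mult[OF assms, of i]] by (simp add: distrib_right)
  qed
  from this[of "{1..L}"] show ?thesis unfolding S_def cay_op_def[abs_def] by simp
qed

lemma S_selfadjoint: "adj S = S"
  unfolding S_def adj_sum by (rule sum.cong) (auto simp: s_selfadjoint)

lemma inner_fs_self: "inner_fs f f = of_real (\<Sum>w | f w \<noteq> 0. (cmod (f w))\<^sup>2)"
  unfolding inner_fs_def of_real_sum by (rule sum.cong) (simp_all add: complex_norm_square mult.commute del: of_real_power)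

lemma infsum_fin_supp:
  assumes "fin_supp f"
  shows "(\<lambda>w. (cmod (f w))\<^sup>2) summable_on TM" "(\<Sum>\<^sub>\<infinity>w\<in>TM. (cmod (f w))\<^sup>2) = Re (inner_fs f f)"
proof -
  have F: "finite {w. f w \<noteq> 0}" "{w. f w \<noteq> 0} \<subseteq> TM" using assms by (auto simp: fin_supp_def)
  have "(\<Sum>\<^sub>\<infinity>w\<in>TM. (cmod (f w))\<^sup>2) = (\<Sum>\<^sub>\<infinity>w\<in>{w. f w \<noteq> 0}. (cmod (f w))\<^sup>2)"
    by (rule infsum_cong_neutral) (use F in auto)
  thus "(\<Sum>\<^sub>\<infinity>w\<in>TM. (cmod (f w))\<^sup>2) = Re (inner_fs f f)" using F by (simp add: inner_fs_self)
  have "(\<lambda>w. (cmod (f w))\<^sup>2) summable_on {w. f w \<noteq> 0}" using F by simp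
  thus "(\<lambda>w. (cmod (f w))\<^sup>2) summable_on TM"
    by (rule summable_on_cong_neutral[THEN iffD1, rotated -1]) (use F in auto)
qed

text \<open>The L2-bound for left multiplication by S, transported through the isometry.\<close>

lemma inner_fs_cay_op_le:
  assumes "fin_supp f" shows "Re (inner_fs (cay_op f) (cay_op f)) \<le> (norm S)\<^sup>2 * Re (inner_fs f f)"
proof -
  obtain x where x: "fock x f" using fock_surj[OF assms] by blast
  show ?thesis using tau_left_mult_le[of S x]
    by (simp add: tau_fock[OF x x] tau_fock[OF fock_S[OF x] fock_S[OF x]])
qed

lemma fin_supp_cay_op: "fin_supp f \<Longrightarrow> fin_supp (cay_op f)"
  using fock_surj fock_S fock_fin_supp by blast

definition unit_ball :: "(nat list set \<Rightarrow> complex) set" where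
  "unit_ball = {f. (\<lambda>w. (cmod (f w))\<^sup>2) summable_on TM \<and> (\<Sum>\<^sub>\<infinity>w\<in>TM. (cmod (f w))\<^sup>2) \<le> 1}"

lemma cay_op_bounded:
  assumes "f \<in> unit_ball"
  shows "sqrt (\<Sum>\<^sub>\<infinity>w\<in>TM. (cmod (cay_adj_op L E f w))\<^sup>2) \<le> norm S"
proof -
  have "(\<Sum>\<^sub>\<infinity>w\<in>TM. (cmod (cay_adj_op L E f w))\<^sup>2) \<le> (norm S)\<^sup>2"
  proof (cases "(\<lambda>w. (cmod (cay_adj_op L E f w))\<^sup>2) summable_on TM")
    \<comment> \<open>The infinite sum of a family that is not summable is 0 by convention.\<close>
    case False
    thus ?thesis by (simp add: infsum_not_exists)
  next
    case True
    thus ?thesis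
    proof (rule infsum_le_finite_sums)
      fix F assume F: "finite F" "F \<subseteq> TM"
      \<comment> \<open>On the finite set F the operator sees only the values of f at neighbours of
        F, so f may be cut down to finite support.\<close>
      define D where "D = (\<Union>w\<in>F. \<Union>v\<in>{1..L}. letter_nbr v w)"
      have D: "finite D" "D \<subseteq> TM" using F finite_letter_nbr by (auto simp: D_def letter_nbr_def)
      define g where "g w = (if w \<in> D then f w else 0)" for w
      have g: "fin_supp g" by (rule fin_supp_subset[of D]) (use D in \<open>auto simp: g_def\<close>)
      have "cay_adj_op L E f w = cay_op g w" if "w \<in> F" for w
      proof -
        have "w \<in> TM" using that F by auto
        moreover have "letter_op v f w = letter_op v g w" if "v \<in> {1..L}" for v
          unfolding letter_op_def using that \<open>w \<in> F\<close> by (auto simp: g_def D_def intro!: sum.cong)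
        ultimately show ?thesis by (simp add: cay_op_def cay_adj_op_eq_sum_letter_op)
      qed
      hence "(\<Sum>w\<in>F. (cmod (cay_adj_op L E f w))\<^sup>2) = (\<Sum>w\<in>F. (cmod (cay_op g w))\<^sup>2)"
        by simp
      also have "\<dots> \<le> (\<Sum>\<^sub>\<infinity>w\<in>TM. (cmod (cay_op g w))\<^sup>2)"
        by (rule finite_sum_le_infsum[OF infsum_fin_supp(1)[OF fin_supp_cay_op[OF g]]]) (use F in auto)
      also have "\<dots> \<le> (norm S)\<^sup>2 * Re (inner_fs g g)"
        unfolding infsum_fin_supp(2)[OF fin_supp_cay_op[OF g]] by (rule inner_fs_cay_op_le[OF g])
      also have "Re (inner_fs g g) \<le> (\<Sum>\<^sub>\<infinity>w\<in>TM. (cmod (f w))\<^sup>2)"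
        unfolding infsum_fin_supp(2)[OF g, symmetric]
        by (rule infsum_mono[OF infsum_fin_supp(1)[OF g]]) (use assms in \<open>auto simp: unit_ball_def g_def\<close>)
      also have "\<dots> \<le> 1" using assms by (simp add: unit_ball_def)
      finally show "(\<Sum>w\<in>F. (cmod (cay_adj_op L E f w))\<^sup>2) \<le> (norm S)\<^sup>2"
        by (simp add: mult_left_mono)
    qed
  qed
  thus ?thesis by (simp add: real_le_lsqrt)
qed

lemma cay_adj_norm_eq:
  "cay_adj_norm L E = (SUP f\<in>unit_ball. sqrt (\<Sum>\<^sub>\<infinity>w\<in>TM. (cmod (cay_adj_op L E f w))\<^sup>2))"
  by (simp add: cay_adj_norm_def unit_ball_def)

lemma cay_adj_norm_le: "cay_adj_norm L E \<le> norm S"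
  unfolding cay_adj_norm_eq
proof (rule cSUP_least)
  have "(\<lambda>_. 0) \<in> unit_ball" by (simp add: unit_ball_def)
  thus "unit_ball \<noteq> {}" by blast
qed (rule cay_op_bounded)

text \<open>A real supremum dominates its members only for a bounded family; the bound by
  \<open>norm S\<close> supplies this.\<close>

lemma cay_adj_norm_upper:
  assumes "f \<in> unit_ball"
  shows "sqrt (\<Sum>\<^sub>\<infinity>w\<in>TM. (cmod (cay_adj_op L E f w))\<^sup>2) \<le> cay_adj_norm L E"
  unfolding cay_adj_norm_eq
  by (rule cSUP_upper[OF assms]) (use cay_op_bounded in \<open>auto intro!: bdd_aboveI2[of _ _ "norm S"]\<close>)

lemma cay_adj_norm_nonneg: "cay_adj_norm L E \<ge> 0"
proof -
  have "(\<lambda>_. 0) \<in> unit_ball" by (simp add: unit_ball_def)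
  from cay_adj_norm_upper[OF this] show ?thesis by (simp add: cay_adj_op_def)
qed

text \<open>A nonzero f is scaled into the unit ball; for f of norm 0 the cruder bound with
  \<open>norm S\<close> already makes the left side vanish.\<close>

lemma inner_fs_cay_op_le_cay_adj_norm:
  assumes f: "fin_supp f" shows "Re (inner_fs (cay_op f) (cay_op f)) \<le> (cay_adj_norm L E)\<^sup>2 * Re (inner_fs f f)"
proof (cases "Re (inner_fs f f) = 0")
  case True
  thus ?thesis using inner_fs_cay_op_le[OF f] by simp
next
  case False
  define r where "r = Re (inner_fs f f)"
  have "r \<ge> 0" unfolding r_def inner_fs_self by (simp add: sum_nonneg)
  hence r: "r > 0" using False by (simp add: r_def)
  define c where "c = 1 / sqrt r"
  have c: "c\<^sup>2 = 1 / r" using r by (simp add: c_def power_divide)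
  define g where "g = (\<lambda>w. of_real c * f w)"
  have sq: "(\<Sum>\<^sub>\<infinity>w\<in>TM. (cmod (of_real c * h w))\<^sup>2) = c\<^sup>2 * (\<Sum>\<^sub>\<infinity>w\<in>TM. (cmod (h w))\<^sup>2)"
    for h :: "nat list set \<Rightarrow> complex"
    by (simp add: norm_mult power_mult_distrib infsum_cmult_right')
  have g: "fin_supp g" unfolding g_def by (rule fin_supp_scale[OF f])
  have "(\<Sum>\<^sub>\<infinity>w\<in>TM. (cmod (g w))\<^sup>2) = 1"
    unfolding g_def sq infsum_fin_supp(2)[OF f] using r by (simp add: c r_def)
  hence "g \<in> unit_ball" using infsum_fin_supp(1)[OF g] by (simp add: unit_ball_def)
  from cay_adj_norm_upper[OF this]
  have "(\<Sum>\<^sub>\<infinity>w\<in>TM. (cmod (cay_adj_op L E g w))\<^sup>2) \<le> (cay_adj_norm L E)\<^sup>2"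
    by (rule sqrt_le_D)
  also have "(\<Sum>\<^sub>\<infinity>w\<in>TM. (cmod (cay_adj_op L E g w))\<^sup>2) = (\<Sum>\<^sub>\<infinity>w\<in>TM. (cmod (of_real c * cay_op f w))\<^sup>2)"
    by (rule infsum_cong) (simp add: cay_op_eq cay_adj_op_def g_def sum_distrib_left)
  also have "\<dots> = Re (inner_fs (cay_op f) (cay_op f)) / r"
    unfolding sq infsum_fin_supp(2)[OF fin_supp_cay_op[OF f]] by (simp add: c)
  finally show ?thesis using r by (simp add: r_def[symmetric] field_simps)
qed

lemma fock_alg_poly_S: "\<exists>f. fock (alg_poly S p) f"
proof (induction p)
  case 0
  show ?case using fock.scale[OF fock.one, of 0] by auto
next
  case (pCons c p)
  then obtain f where "fock (alg_poly S p) f" by blast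
  from fock.add[OF fock.scale[OF fock.one, of "of_real c"] fock_S[OF this]]
  show ?case by (auto simp: alg_poly_pCons scaleC_of_real)
qed

theorem norm_S: "norm S = cay_adj_norm L E"
proof (rule antisym[OF _ cay_adj_norm_le])
  show "norm S \<le> cay_adj_norm L E"
  proof (rule dense_ge)
    \<comment> \<open>The contraction criterion asks for a positive bound, while the adjacency norm
      may be 0, as for L = 0; hence a strictly larger M.\<close>
    fix M assume M: "cay_adj_norm L E < M"
    show "norm S \<le> M"
    proof (rule norm_le_if_L2_contraction[OF _ S_selfadjoint])
      show "0 < M" using M cay_adj_norm_nonneg by linarith
      fix p :: "real poly"
      define x where "x = alg_poly S p"
      obtain f where f: "fock x f" using fock_alg_poly_S x_def by blast
      have "S * x = alg_poly S (pCons 0 p)" by (simp add: x_def alg_poly_pCons)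
      hence adj: "adj (S * x) = S * x" "adj x = x" by (simp_all add: x_def adj_alg_poly S_selfadjoint)
      have "Re (\<tau> ((S * x) * (S * x))) \<le> (cay_adj_norm L E)\<^sup>2 * Re (\<tau> (x * x))"
        using inner_fs_cay_op_le_cay_adj_norm[OF fock_fin_supp[OF f]] tau_fock[OF f f] tau_fock[OF fock_S[OF f] fock_S[OF f]] adj
        by simp
      also have "\<dots> \<le> M\<^sup>2 * Re (\<tau> (x * x))"
        using M cay_adj_norm_nonneg tau_pos[of x] adj by (intro mult_right_mono power_mono) auto
      finally show "Re (\<tau> (S * alg_poly S p * (S * alg_poly S p))) \<le> M\<^sup>2 * Re (\<tau> (alg_poly S p * alg_poly S p))"
        by (simp add: x_def)
    qed
  qed
qed

end

theorem theorem1p4: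
  fixes L :: nat and E :: "nat \<Rightarrow> nat \<Rightarrow> bool"
    and \<tau> :: "'a::cstar_algebra \<Rightarrow> complex" and s :: "nat \<Rightarrow> 'a"
  assumes "simple_graph_on L E"
    and "faithful_tracial_state \<tau>"
    and "\<forall>i\<in>{1..L}. semicircle_var \<tau> (s i)"
    and "G_independent_vars L E \<tau> s"
  shows "norm (\<Sum>i=1..L. s i) = cay_adj_norm L E"
proof -
  interpret graph_semicirculars L E \<tau> s
    by unfold_locales (use assms in auto)
  show ?thesis using norm_S by (simp add: S_def)
qed

end
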